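(* Let $T$ be a positive theory, $C$ any (small) parameter set, $\kappa$ any cardinal, and $\lambda=\beth_{(2^{|T|+|C|+\kappa})^+}$. Given any tree $(a_\eta)_{\eta\in\omega^{<\lambda}}$ of $\kappa$-tuples that is s-indiscernible over $C$, there is a tree $(b_\eta)_{\eta\in\omega^{<\omega}}$ that is str-indiscernible over $C$ and str-based on $(a_\eta)_{\eta\in\omega^{<\lambda}}$ over $C$.
   Context: Work in a monster model (existentially closed, very homogeneous, very saturated) of a positive theory $T$; formulas are positive (built from atomic formulas by $\wedge,\vee,\top,\bot,\exists$), and $a\equiv_C b$ means equal positive types over $C$. Trees: for ordinals $\alpha,\beta$, $\alpha^{<\beta}$ is the set of functions $\eta:\gamma\to\alpha$ with $\gamma<\beta$; $\ell(\eta)=\gamma$ is its length. $\eta\unlhd\nu$ iff $\nu$ extends $\eta$; $\eta\wedge\nu$ is the largest common initial segment; $\eta<_{\mathrm{lex}}\nu$ iff $\eta\lhd\nu$, or they are incomparable and $\eta(\gamma)<\nu(\gamma)$ for the least $\gamma$ with $\eta(\gamma)\neq\nu(\gamma)$; $\eta<_{\mathrm{len}}\nu$ iff $\ell(\eta)<\ell(\nu)$; $P_\gamma=\{\eta:\ell(\eta)=\gamma\}$ for $\gamma<\beta$. Shelah language $\mathcal{L}_{\mathrm{s}}=\{\unlhd,\wedge,<_{\mathrm{lex}},(P_\gamma)_{\gamma<\beta}\}$; strong Shelah language $\mathcal{L}_{\mathrm{str}}=\{\unlhd,\wedge,<_{\mathrm{lex}},<_{\mathrm{len}}\}$. For finite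 tuples $\bar\eta=(\eta_1,\dots,\eta_n)$, $a_{\bar\eta}=(a_{\eta_1},\dots,a_{\eta_n})$, and $\bar\eta\equiv^{\mathrm{s\text{-}qf}}\bar\nu$ (resp. $\equiv^{\mathrm{str\text{-}qf}}$) means equal quantifier-free $\mathcal{L}_{\mathrm{s}}$-type (resp. $\mathcal{L}_{\mathrm{str}}$-type), in the full first-order sense. A tree $(a_\eta)$ is s-indiscernible (resp. str-indiscernible) over $C$ if $\bar\eta\equiv^{\mathrm{s\text{-}qf}}\bar\nu$ (resp. $\equiv^{\mathrm{str\text{-}qf}}$) implies $a_{\bar\eta}\equiv_C a_{\bar\nu}$. $(b_\eta)_{\eta\in\omega^{<\omega}}$ is str-based on $(a_\eta)_{\eta\in\omega^{<\lambda}}$ over $C$ if for every finite tuple $\bar\eta$ in $\omega^{<\omega}$ there is a tuple $\bar\nu$ in $\omega^{<\lambda}$ with $\bar\nu\equiv^{\mathrm{str\text{-}qf}}\bar\eta$ and $b_{\bar\eta}\equiv_C a_{\bar\nu}$. *)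

theory Defs
  imports Main
begin

unbundle cardinal_syntax

section \<open>Positive logic\<close>

record ('f, 'r) signature =
  funs :: "'f set"
  rels :: "'r set"
  farity :: "'f \<Rightarrow> nat"
  rarity :: "'r \<Rightarrow> nat"

datatype 'f tm = Var nat | Fn 'f "'f tm list"

datatype ('f, 'r) fm =
    Top
  | Bot
  | Eq "'f tm" "'f tm"
  | Rel 'r "'f tm list"
  | Conj "('f, 'r) fm" "('f, 'r) fm"
  | Disj "('f, 'r) fm" "('f, 'r) fm"
  | Ex nat "('f, 'r) fm"

fun wf_tm :: "('f, 'r) signature \<Rightarrow> 'f tm \<Rightarrow> bool" where
  "wf_tm L (Var n) \<longleftrightarrow> True"
| "wf_tm L (Fn f ts) \<longleftrightarrow> f \<in> funs L \<and> length ts = farity L f \<and> (\<forall>t\<in>set ts. wf_tm L t)"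

fun wf_fm :: "('f, 'r) signature \<Rightarrow> ('f, 'r) fm \<Rightarrow> bool" where
  "wf_fm L Top \<longleftrightarrow> True"
| "wf_fm L Bot \<longleftrightarrow> True"
| "wf_fm L (Eq s t) \<longleftrightarrow> wf_tm L s \<and> wf_tm L t"
| "wf_fm L (Rel R ts) \<longleftrightarrow> R \<in> rels L \<and> length ts = rarity L R \<and> (\<forall>t\<in>set ts. wf_tm L t)"
| "wf_fm L (Conj \<phi> \<psi>) \<longleftrightarrow> wf_fm L \<phi> \<and> wf_fm L \<psi>"
| "wf_fm L (Disj \<phi> \<psi>) \<longleftrightarrow> wf_fm L \<phi> \<and> wf_fm L \<psi>"
| "wf_fm L (Ex n \<phi>) \<longleftrightarrow> wf_fm L \<phi>"

definition Fm :: "('f, 'r) signature \<Rightarrow> ('f, 'r) fm set" where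
  "Fm L = {\<phi>. wf_fm L \<phi>}"

record ('m, 'f, 'r) struct =
  dom_of :: "'m set"
  fint :: "'f \<Rightarrow> 'm list \<Rightarrow> 'm"
  rint :: "'r \<Rightarrow> 'm list \<Rightarrow> bool"

definition is_structure :: "('f, 'r) signature \<Rightarrow> ('m, 'f, 'r) struct \<Rightarrow> bool" where
  "is_structure L M \<longleftrightarrow> dom_of M \<noteq> {} \<and>
     (\<forall>f\<in>funs L. \<forall>xs. set xs \<subseteq> dom_of M \<and> length xs = farity L f \<longrightarrow> fint M f xs \<in> dom_of M)"

fun val :: "('m, 'f, 'r) struct \<Rightarrow> (nat \<Rightarrow> 'm) \<Rightarrow> 'f tm \<Rightarrow> 'm" where
  "val M v (Var n) = v n"
| "val M v (Fn f ts) = fint M f (map (val M v) ts)"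

fun holds :: "('m, 'f, 'r) struct \<Rightarrow> (nat \<Rightarrow> 'm) \<Rightarrow> ('f, 'r) fm \<Rightarrow> bool" where
  "holds M v Top \<longleftrightarrow> True"
| "holds M v Bot \<longleftrightarrow> False"
| "holds M v (Eq s t) \<longleftrightarrow> val M v s = val M v t"
| "holds M v (Rel R ts) \<longleftrightarrow> rint M R (map (val M v) ts)"
| "holds M v (Conj \<phi> \<psi>) \<longleftrightarrow> holds M v \<phi> \<and> holds M v \<psi>"
| "holds M v (Disj \<phi> \<psi>) \<longleftrightarrow> holds M v \<phi> \<or> holds M v \<psi>"
| "holds M v (Ex n \<phi>) \<longleftrightarrow> (\<exists>x\<in>dom_of M. holds M (v(n := x)) \<phi>)"

text \<open>A pair \<open>(\<phi>, \<psi>)\<close> stands for the h-inductive sentence \<open>\<forall>x. \<phi>(x) \<longrightarrow> \<psi>(x)\<close>;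
  a positive theory is a set of such sentences.\<close>

type_synonym ('f, 'r) h_inductive = "('f, 'r) fm \<times> ('f, 'r) fm"

definition positive_theory :: "('f, 'r) signature \<Rightarrow> ('f, 'r) h_inductive set \<Rightarrow> bool" where
  "positive_theory L T \<longleftrightarrow> T \<subseteq> Fm L \<times> Fm L"

definition is_model ::
  "('f, 'r) signature \<Rightarrow> ('f, 'r) h_inductive set \<Rightarrow> ('m, 'f, 'r) struct \<Rightarrow> bool" where
  "is_model L T M \<longleftrightarrow> is_structure L M \<and>
     (\<forall>(\<phi>, \<psi>)\<in>T. \<forall>v. range v \<subseteq> dom_of M \<longrightarrow> holds M v \<phi> \<longrightarrow> holds M v \<psi>)"

definition homomorphism ::
  "('f, 'r) signature \<Rightarrow> ('m, 'f, 'r) struct \<Rightarrow> ('n, 'f, 'r) struct \<Rightarrow> ('m \<Rightarrow> 'n) \<Rightarrow> bool" where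
  "homomorphism L M N h \<longleftrightarrow> h ` dom_of M \<subseteq> dom_of N \<and>
     (\<forall>f\<in>funs L. \<forall>xs. set xs \<subseteq> dom_of M \<and> length xs = farity L f \<longrightarrow>
        h (fint M f xs) = fint N f (map h xs)) \<and>
     (\<forall>R\<in>rels L. \<forall>xs. set xs \<subseteq> dom_of M \<and> length xs = rarity L R \<longrightarrow>
        rint M R xs \<longrightarrow> rint N R (map h xs))"

definition automorphism ::
  "('f, 'r) signature \<Rightarrow> ('m, 'f, 'r) struct \<Rightarrow> ('m \<Rightarrow> 'm) \<Rightarrow> bool" where
  "automorphism L M h \<longleftrightarrow> bij_betw h (dom_of M) (dom_of M) \<and>
     homomorphism L M M h \<and> homomorphism L M M (inv_into (dom_of M) h)"

definition immersion ::
  "('f, 'r) signature \<Rightarrow> ('m, 'f, 'r) struct \<Rightarrow> ('n, 'f, 'r) struct \<Rightarrow> ('m \<Rightarrow> 'n) \<Rightarrow> bool" where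
  "immersion L M N h \<longleftrightarrow> homomorphism L M N h \<and>
     (\<forall>\<phi>\<in>Fm L. \<forall>v. range v \<subseteq> dom_of M \<longrightarrow> (holds M v \<phi> \<longleftrightarrow> holds N (h \<circ> v) \<phi>))"

text \<open>A model is existentially closed if every homomorphism from it into a model is an immersion.
  HOL cannot quantify over structures on all types at once, so the target models are taken on one
  type that is large enough: by downward Loewenheim-Skolem, every homomorphism
  \<open>h\<close> from \<open>M\<close> into a model \<open>N\<close> has its image inside an elementary substructure
  of \<open>N\<close> of cardinality at most \<open>|M| + |Fm L|\<close>, and such a substructure has a copy on
  the type \<^typ>\<open>('m + ('f, 'r) fm) set\<close>.\<close>

definition existentially_closed ::
  "('f, 'r) signature \<Rightarrow> ('f, 'r) h_inductive set \<Rightarrow> ('m, 'f, 'r) struct \<Rightarrow> bool" where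
  "existentially_closed L T M \<longleftrightarrow> is_model L T M \<and>
     (\<forall>(N :: (('m + ('f, 'r) fm) set, 'f, 'r) struct) h.
        is_model L T N \<and> homomorphism L M N h \<longrightarrow> immersion L M N h)"

text \<open>A formula over \<open>C\<close> in the (possibly infinitely many) variables indexed by \<open>J\<close> is a pair
  \<open>(\<phi>, s)\<close>: the substitution \<open>s\<close> replaces each of the variables of \<open>\<phi>\<close> by an indexed variable
  \<open>Inl j\<close> or by a parameter \<open>Inr c\<close>.\<close>

type_synonym ('j, 'm, 'f, 'r) pfm = "('f, 'r) fm \<times> (nat \<Rightarrow> 'j + 'm)"

definition Pfm :: "('f, 'r) signature \<Rightarrow> 'j set \<Rightarrow> 'm set \<Rightarrow> ('j, 'm, 'f, 'r) pfm set" where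
  "Pfm L J C = {(\<phi>, s). \<phi> \<in> Fm L \<and> range s \<subseteq> J <+> C}"

definition satisfies ::
  "('m, 'f, 'r) struct \<Rightarrow> ('j \<Rightarrow> 'm) \<Rightarrow> ('j, 'm, 'f, 'r) pfm \<Rightarrow> bool" where
  "satisfies M a p \<longleftrightarrow> holds M (case_sum a id \<circ> snd p) (fst p)"

definition positive_type ::
  "('f, 'r) signature \<Rightarrow> ('m, 'f, 'r) struct \<Rightarrow> 'm set \<Rightarrow> 'j set \<Rightarrow> ('j \<Rightarrow> 'm) \<Rightarrow>
     ('j, 'm, 'f, 'r) pfm set" where
  "positive_type L M C J a = {p \<in> Pfm L J C. satisfies M a p}"


section \<open>Monster models\<close>

text \<open>The cardinal \<open>\<mu>\<close> bounds smallness: a set is small if its cardinality is less than \<open>\<mu>\<close>.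
  Index sets of small tuples of variables may be taken inside \<open>Field \<mu>\<close>.\<close>

definition saturated :: "('f, 'r) signature \<Rightarrow> 's rel \<Rightarrow> ('m, 'f, 'r) struct \<Rightarrow> bool" where
  "saturated L \<mu> M \<longleftrightarrow>
     (\<forall>C J \<Sigma>. C \<subseteq> dom_of M \<and> |C| <o \<mu> \<and> J \<subseteq> Field \<mu> \<and> |J| <o \<mu> \<and> \<Sigma> \<subseteq> Pfm L J C \<longrightarrow>
        (\<forall>\<Sigma>0. finite \<Sigma>0 \<and> \<Sigma>0 \<subseteq> \<Sigma> \<longrightarrow> (\<exists>a. a ` J \<subseteq> dom_of M \<and> (\<forall>p\<in>\<Sigma>0. satisfies M a p))) \<longrightarrow>
        (\<exists>a. a ` J \<subseteq> dom_of M \<and> (\<forall>p\<in>\<Sigma>. satisfies M a p)))"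

definition homogeneous :: "('f, 'r) signature \<Rightarrow> 's rel \<Rightarrow> ('m, 'f, 'r) struct \<Rightarrow> bool" where
  "homogeneous L \<mu> M \<longleftrightarrow>
     (\<forall>A f. A \<subseteq> dom_of M \<and> |A| <o \<mu> \<and> f ` A \<subseteq> dom_of M \<and>
        (\<forall>\<phi>\<in>Fm L. \<forall>v. range v \<subseteq> A \<longrightarrow> (holds M v \<phi> \<longleftrightarrow> holds M (f \<circ> v) \<phi>)) \<longrightarrow>
        (\<exists>h. automorphism L M h \<and> (\<forall>x\<in>A. h x = f x)))"

definition monster ::
  "('f, 'r) signature \<Rightarrow> ('f, 'r) h_inductive set \<Rightarrow> 's rel \<Rightarrow> ('m, 'f, 'r) struct \<Rightarrow> bool" where
  "monster L T \<mu> M \<longleftrightarrow> Card_order \<mu> \<and> |Fm L| <o \<mu> \<and>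
     existentially_closed L T M \<and> saturated L \<mu> M \<and> homogeneous L \<mu> M"


section \<open>Beth numbers\<close>

text \<open>Read \<open>J\<close> as an initial segment of the well-order \<open>r\<close> and \<open>|B j|\<close> as \<open>\<beth>\<^sub>j\<close> for \<open>j \<in> J\<close>.
  Then \<open>c\<close> is \<open>\<beth>\<close> at the order type of \<open>J\<close>. The three clauses are the cases zero,
  successor (\<open>J\<close> has a largest element) and limit.\<close>

definition beth_step :: "'o rel \<Rightarrow> 'o set \<Rightarrow> ('o \<Rightarrow> 'l set) \<Rightarrow> 'l rel \<Rightarrow> bool" where
  "beth_step r J B c \<longleftrightarrow>
     (J = {} \<longrightarrow> c =o natLeq) \<and>
     (\<forall>j\<in>J. J \<subseteq> under r j \<longrightarrow> c =o ctwo ^c |B j| ) \<and>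
     (J \<noteq> {} \<and> (\<forall>j\<in>J. \<not> J \<subseteq> under r j) \<longrightarrow>
        (\<forall>j\<in>J. |B j| \<le>o c) \<and>
        (\<forall>X :: 'l set. (\<forall>j\<in>J. |B j| \<le>o |X| ) \<longrightarrow> c \<le>o |X| ))"

text \<open>\<open>is_beth r l\<close>: the cardinal \<open>l\<close> equals \<open>\<beth>\<^sub>\<alpha>\<close>, where \<open>\<alpha>\<close> is the order type of \<open>r\<close>.
  All earlier values are at most \<open>l\<close>, hence they are realised by sets over the type of \<open>l\<close>.\<close>

definition is_beth :: "'o rel \<Rightarrow> 'l rel \<Rightarrow> bool" where
  "is_beth r l \<longleftrightarrow> Well_order r \<and> Card_order l \<and>
     (\<exists>B :: 'o \<Rightarrow> 'l set.
        (\<forall>i\<in>Field r. beth_step r (underS r i) B |B i| ) \<and> beth_step r (Field r) B l)"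


section \<open>Trees\<close>

text \<open>An ordinal \<open>\<beta>\<close> is given as a well-order \<open>r\<close>; the elements of \<open>Field r\<close> are the ordinals
  below \<open>\<beta>\<close>, and \<open>\<gamma> \<in> Field r\<close> as a von Neumann ordinal is the set \<open>underS r \<gamma>\<close>. So the following
  is \<open>\<omega>\<^bsup><\<beta>\<^esup>\<close>, and \<open>tree natLeq\<close> is \<open>\<omega>\<^bsup><\<omega>\<^esup>\<close>.\<close>

type_synonym 'i node = "'i \<Rightarrow> nat option"

definition tree :: "'i rel \<Rightarrow> 'i node set" where
  "tree r = {\<eta>. \<exists>\<gamma>\<in>Field r. dom \<eta> = underS r \<gamma>}"

definition node_len :: "'i rel \<Rightarrow> 'i node \<Rightarrow> 'i" where
  "node_len r \<eta> = (THE \<gamma>. \<gamma> \<in> Field r \<and> dom \<eta> = underS r \<gamma>)"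

abbreviation node_ext :: "'i node \<Rightarrow> 'i node \<Rightarrow> bool" where
  "node_ext \<eta> \<nu> \<equiv> \<eta> \<subseteq>\<^sub>m \<nu>"

definition node_meet :: "'i rel \<Rightarrow> 'i node \<Rightarrow> 'i node \<Rightarrow> 'i node" where
  "node_meet r \<eta> \<nu> = \<eta> |` {i \<in> dom \<eta> \<inter> dom \<nu>. \<forall>j\<in>under r i. \<eta> j = \<nu> j}"

text \<open>A \<open>\<gamma>\<close> as in the second disjunct exists only for incomparable nodes.\<close>

definition node_lex :: "'i rel \<Rightarrow> 'i node \<Rightarrow> 'i node \<Rightarrow> bool" where
  "node_lex r \<eta> \<nu> \<longleftrightarrow> (node_ext \<eta> \<nu> \<and> \<eta> \<noteq> \<nu>) \<or>
     (\<exists>\<gamma>\<in>dom \<eta> \<inter> dom \<nu>. (\<forall>j\<in>underS r \<gamma>. \<eta> j = \<nu> j) \<and> the (\<eta> \<gamma>) < the (\<nu> \<gamma>))"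

definition node_shorter :: "'i rel \<Rightarrow> 'i node \<Rightarrow> 'i node \<Rightarrow> bool" where
  "node_shorter r \<eta> \<nu> \<longleftrightarrow> (node_len r \<eta>, node_len r \<nu>) \<in> r - Id"


section \<open>Quantifier-free types in trees\<close>

datatype tree_tm = TVar nat | TMeet tree_tm tree_tm

datatype 'i s_atom =
    SEq tree_tm tree_tm
  | SExt tree_tm tree_tm
  | SLex tree_tm tree_tm
  | SLevel 'i tree_tm

datatype str_atom =
    StrEq tree_tm tree_tm
  | StrExt tree_tm tree_tm
  | StrLex tree_tm tree_tm
  | StrLen tree_tm tree_tm

datatype 'a qf =
    QTrue
  | QAtom 'a
  | QNeg "'a qf"
  | QAnd "'a qf" "'a qf"
  | QOr "'a qf" "'a qf"

fun tm_vars :: "tree_tm \<Rightarrow> nat set" where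
  "tm_vars (TVar n) = {n}"
| "tm_vars (TMeet s t) = tm_vars s \<union> tm_vars t"

fun s_vars :: "'i s_atom \<Rightarrow> nat set" where
  "s_vars (SEq s t) = tm_vars s \<union> tm_vars t"
| "s_vars (SExt s t) = tm_vars s \<union> tm_vars t"
| "s_vars (SLex s t) = tm_vars s \<union> tm_vars t"
| "s_vars (SLevel \<gamma> t) = tm_vars t"

fun str_vars :: "str_atom \<Rightarrow> nat set" where
  "str_vars (StrEq s t) = tm_vars s \<union> tm_vars t"
| "str_vars (StrExt s t) = tm_vars s \<union> tm_vars t"
| "str_vars (StrLex s t) = tm_vars s \<union> tm_vars t"
| "str_vars (StrLen s t) = tm_vars s \<union> tm_vars t"

fun tm_val :: "'i rel \<Rightarrow> 'i node list \<Rightarrow> tree_tm \<Rightarrow> 'i node" where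
  "tm_val r \<eta>s (TVar n) = \<eta>s ! n"
| "tm_val r \<eta>s (TMeet s t) = node_meet r (tm_val r \<eta>s s) (tm_val r \<eta>s t)"

fun s_true :: "'i rel \<Rightarrow> 'i node list \<Rightarrow> 'i s_atom \<Rightarrow> bool" where
  "s_true r \<eta>s (SEq s t) \<longleftrightarrow> tm_val r \<eta>s s = tm_val r \<eta>s t"
| "s_true r \<eta>s (SExt s t) \<longleftrightarrow> node_ext (tm_val r \<eta>s s) (tm_val r \<eta>s t)"
| "s_true r \<eta>s (SLex s t) \<longleftrightarrow> node_lex r (tm_val r \<eta>s s) (tm_val r \<eta>s t)"
| "s_true r \<eta>s (SLevel \<gamma> t) \<longleftrightarrow> \<gamma> \<in> Field r \<and> node_len r (tm_val r \<eta>s t) = \<gamma>"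

fun str_true :: "'i rel \<Rightarrow> 'i node list \<Rightarrow> str_atom \<Rightarrow> bool" where
  "str_true r \<eta>s (StrEq s t) \<longleftrightarrow> tm_val r \<eta>s s = tm_val r \<eta>s t"
| "str_true r \<eta>s (StrExt s t) \<longleftrightarrow> node_ext (tm_val r \<eta>s s) (tm_val r \<eta>s t)"
| "str_true r \<eta>s (StrLex s t) \<longleftrightarrow> node_lex r (tm_val r \<eta>s s) (tm_val r \<eta>s t)"
| "str_true r \<eta>s (StrLen s t) \<longleftrightarrow> node_shorter r (tm_val r \<eta>s s) (tm_val r \<eta>s t)"

fun qf_true :: "('a \<Rightarrow> bool) \<Rightarrow> 'a qf \<Rightarrow> bool" where
  "qf_true V QTrue \<longleftrightarrow> True"
| "qf_true V (QAtom A) \<longleftrightarrow> V A"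
| "qf_true V (QNeg \<phi>) \<longleftrightarrow> \<not> qf_true V \<phi>"
| "qf_true V (QAnd \<phi> \<psi>) \<longleftrightarrow> qf_true V \<phi> \<and> qf_true V \<psi>"
| "qf_true V (QOr \<phi> \<psi>) \<longleftrightarrow> qf_true V \<phi> \<or> qf_true V \<psi>"

text \<open>The quantifier-free type of an \<open>n\<close>-tuple consists of the formulas in the variables
  \<open>0, \<dots>, n - 1\<close> that it satisfies.\<close>

definition s_qf_type :: "'i rel \<Rightarrow> 'i node list \<Rightarrow> 'i s_atom qf set" where
  "s_qf_type r \<eta>s =
     {\<phi>. (\<forall>A\<in>set_qf \<phi>. s_vars A \<subseteq> {..<length \<eta>s}) \<and> qf_true (s_true r \<eta>s) \<phi>}"

definition str_qf_type :: "'i rel \<Rightarrow> 'i node list \<Rightarrow> str_atom qf set" where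
  "str_qf_type r \<eta>s =
     {\<phi>. (\<forall>A\<in>set_qf \<phi>. str_vars A \<subseteq> {..<length \<eta>s}) \<and> qf_true (str_true r \<eta>s) \<phi>}"

definition s_qf_equiv :: "'i rel \<Rightarrow> 'i node list \<Rightarrow> 'i node list \<Rightarrow> bool" where
  "s_qf_equiv r \<eta>s \<nu>s \<longleftrightarrow> length \<eta>s = length \<nu>s \<and> s_qf_type r \<eta>s = s_qf_type r \<nu>s"

text \<open>The language of \<open>str_atom\<close> does not mention the height of the tree, so tuples from two
  different trees can be compared.\<close>

definition str_qf_equiv :: "'i rel \<Rightarrow> 'i node list \<Rightarrow> 'j rel \<Rightarrow> 'j node list \<Rightarrow> bool" where
  "str_qf_equiv r \<eta>s r' \<nu>s \<longleftrightarrow> length \<eta>s = length \<nu>s \<and> str_qf_type r \<eta>s = str_qf_type r' \<nu>s"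


section \<open>Indiscernible trees\<close>

text \<open>For a cardinal \<open>\<kappa>\<close>, a \<open>\<kappa>\<close>-tuple is a function on \<open>Field \<kappa>\<close>. A tuple of \<open>n\<close> such tuples
  is a family indexed by \<open>{..<n} \<times> Field \<kappa>\<close>.\<close>

definition is_tuple_tree ::
  "('m, 'f, 'r) struct \<Rightarrow> 'k rel \<Rightarrow> 'i rel \<Rightarrow> ('i node \<Rightarrow> 'k \<Rightarrow> 'm) \<Rightarrow> bool" where
  "is_tuple_tree M \<kappa> r a \<longleftrightarrow> (\<forall>\<eta>\<in>tree r. \<forall>i\<in>Field \<kappa>. a \<eta> i \<in> dom_of M)"

definition tuple_at :: "('i node \<Rightarrow> 'k \<Rightarrow> 'm) \<Rightarrow> 'i node list \<Rightarrow> nat \<times> 'k \<Rightarrow> 'm" where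
  "tuple_at a \<eta>s = (\<lambda>(n, i). a (\<eta>s ! n) i)"

text \<open>\<open>a\<^bsub>\<eta>s\<^esub> \<equiv>\<^sub>C b\<^bsub>\<nu>s\<^esub>\<close>\<close>

definition same_type ::
  "('f, 'r) signature \<Rightarrow> ('m, 'f, 'r) struct \<Rightarrow> 'k rel \<Rightarrow> 'm set \<Rightarrow>
     ('i node \<Rightarrow> 'k \<Rightarrow> 'm) \<Rightarrow> 'i node list \<Rightarrow> ('j node \<Rightarrow> 'k \<Rightarrow> 'm) \<Rightarrow> 'j node list \<Rightarrow> bool" where
  "same_type L M \<kappa> C a \<eta>s b \<nu>s \<longleftrightarrow> length \<eta>s = length \<nu>s \<and>
     positive_type L M C ({..<length \<eta>s} \<times> Field \<kappa>) (tuple_at a \<eta>s) =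
     positive_type L M C ({..<length \<nu>s} \<times> Field \<kappa>) (tuple_at b \<nu>s)"

definition s_indiscernible ::
  "('f, 'r) signature \<Rightarrow> ('m, 'f, 'r) struct \<Rightarrow> 'k rel \<Rightarrow> 'm set \<Rightarrow>
     'i rel \<Rightarrow> ('i node \<Rightarrow> 'k \<Rightarrow> 'm) \<Rightarrow> bool" where
  "s_indiscernible L M \<kappa> C r a \<longleftrightarrow>
     (\<forall>\<eta>s \<nu>s. set \<eta>s \<subseteq> tree r \<and> set \<nu>s \<subseteq> tree r \<and> s_qf_equiv r \<eta>s \<nu>s \<longrightarrow>
        same_type L M \<kappa> C a \<eta>s a \<nu>s)"

definition str_indiscernible ::
  "('f, 'r) signature \<Rightarrow> ('m, 'f, 'r) struct \<Rightarrow> 'k rel \<Rightarrow> 'm set \<Rightarrow>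
     'i rel \<Rightarrow> ('i node \<Rightarrow> 'k \<Rightarrow> 'm) \<Rightarrow> bool" where
  "str_indiscernible L M \<kappa> C r a \<longleftrightarrow>
     (\<forall>\<eta>s \<nu>s. set \<eta>s \<subseteq> tree r \<and> set \<nu>s \<subseteq> tree r \<and> str_qf_equiv r \<eta>s r \<nu>s \<longrightarrow>
        same_type L M \<kappa> C a \<eta>s a \<nu>s)"

definition str_based ::
  "('f, 'r) signature \<Rightarrow> ('m, 'f, 'r) struct \<Rightarrow> 'k rel \<Rightarrow> 'm set \<Rightarrow>
     'j rel \<Rightarrow> ('j node \<Rightarrow> 'k \<Rightarrow> 'm) \<Rightarrow> 'i rel \<Rightarrow> ('i node \<Rightarrow> 'k \<Rightarrow> 'm) \<Rightarrow> bool" where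
  "str_based L M \<kappa> C r' b r a \<longleftrightarrow>
     (\<forall>\<eta>s. set \<eta>s \<subseteq> tree r' \<longrightarrow>
        (\<exists>\<nu>s. set \<nu>s \<subseteq> tree r \<and> str_qf_equiv r \<nu>s r' \<eta>s \<and> same_type L M \<kappa> C b \<eta>s a \<nu>s))"

end

theory Submission
  imports Defs
begin

text \<open>For a strictly increasing sequence of levels \<open>h\<close> below \<open>\<lambda>\<close>, spreading the finite sequences
  along \<open>h\<close> embeds \<open>\<omega>\<^bsup><\<omega>\<^esup>\<close> into \<open>\<omega>\<^bsup><\<lambda>\<^esup>\<close> and respects the strong Shelah language. If two tuples of
  \<open>\<omega>\<^bsup><\<omega>\<^esup>\<close> have the same str-type, then for suitable subsequences of \<open>h\<close> the images also have the same
  levels, hence the same s-type. So it is enough to make the type of the image of a tuple independent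
  of the levels: colour a finite set of levels by the type of the subtree on it. There are at most
  \<open>2\<^bsup>|T| + |C| + \<kappa>\<^esup>\<close> colours, so the Erdos-Rado argument, iterated along the successor of this cardinal
  with a pigeonhole at each arity as in Morley's theorem on omitting types, gives for each \<open>n\<close> an
  infinite homogeneous set of levels for the arities up to \<open>n\<close>, with colours that do not depend on
  \<open>n\<close>. The limit type so obtained is realised by saturation. The realisation may a priori satisfy
  more positive formulas, but types of tuples in an existentially closed model are maximal.\<close>

text \<open>The index of the beth number has two sources. \<open>|Fm L|\<close> plays the part of
  |T|. A colour is a set of formulas with finitely many parameters; there are at most |T| + |C| +
  \<kappa> such formulas, hence the power of two. The successor is taken for its regularity: if
  every colour failed at some index below it, the failures would be bounded, and a homogeneous set
  taken above the bound would refute one of them. The homogeneous sets of different arities are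
  unrelated to each other, so \<open>b\<close> is built as a limit and not as a subtree of
  \<open>a\<close>. The zeros between the chosen levels make the embedding respect meets: two spread
  nodes can first differ on a chosen level only. Positive formulas have no negations, so saturation
  gives one inclusion of types. The other rests on a compactness argument: in an existentially
  closed model a formula that fails is excluded by a positive formula that holds. It is carried out
  with an ultrapower of \<open>M\<close> itself, whose index set consists of finite lists of atomic
  conditions, so that it fits on the single type over which \<open>existentially_closed\<close>
  quantifies.\<close>

section \<open>Cardinal arithmetic\<close>

lemma card_of_lists_le:
  assumes "infinite A"
  shows "|lists A| \<le>o |A|"
proof -
  have len: "|{xs \<in> lists A. length xs = n}| \<le>o |A|" for n
  proof (induction n)
    case 0
    have "{xs \<in> lists A. length xs = 0} = {[]}" by auto
    moreover obtain x where "x \<in> A" using assms by fastforce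
    ultimately show ?case by (metis card_of_singl_ordLeq empty_iff)
  next
    case (Suc n)
    let ?B = "{xs \<in> lists A. length xs = n}"
    have "{xs \<in> lists A. length xs = Suc n} \<subseteq> (\<lambda>(x, xs). x # xs) ` (A \<times> ?B)"
      by (auto simp: length_Suc_conv image_iff)
    hence "|{xs \<in> lists A. length xs = Suc n}| \<le>o |A \<times> ?B|"
      by (rule surj_imp_ordLeq)
    moreover have "|A \<times> ?B| \<le>o |A|"
      by (rule card_of_Sigma_ordLeq_infinite[OF assms]) (auto simp: Suc card_of_refl ordIso_imp_ordLeq)
    ultimately show ?case by (rule ordLeq_transitive)
  qed
  have "lists A = (\<Union>n. {xs \<in> lists A. length xs = n})" by auto
  moreover have "|\<Union>n. {xs \<in> lists A. length xs = n}| \<le>o |A|"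
    by (rule card_of_UNION_ordLeq_infinite[OF assms])
      (use assms len in \<open>auto simp: infinite_iff_card_of_nat\<close>)
  ultimately show ?thesis by simp
qed

lemma Card_order_lists_le:
  assumes "Cinfinite r" "|A| \<le>o r"
  shows "|lists A| \<le>o r"
proof -
  have "|Field r| =o r" using assms(1) by (simp add: card_of_Field_ordIso)
  hence "|A| \<le>o |Field r|" using assms(2) ordIso_symmetric ordLeq_ordIso_trans by blast
  then obtain f where f: "inj_on f A" "f ` A \<subseteq> Field r"
    using card_of_ordLeq by metis
  have "inj_on (map f) (lists A)" using f(1)
    by (intro inj_onI) (metis in_lists_conv_set inj_on_map_eq_map inj_on_subset subsetI Un_least)
  moreover have "map f ` lists A \<subseteq> lists (Field r)" using f(2) by (fastforce simp: in_lists_conv_set)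
  ultimately have "|lists A| \<le>o |lists (Field r)|" using card_of_ordLeq by metis
  also have "|lists (Field r)| \<le>o |Field r|"
    using assms(1) by (intro card_of_lists_le) (simp add: cinfinite_def)
  also have "|Field r| =o r" by fact
  finally show ?thesis .
qed

lemma Linear_order_finite_max:
  assumes "Linear_order r" "finite t" "t \<noteq> {}" "t \<subseteq> Field r"
  shows "\<exists>m\<in>t. \<forall>j\<in>t. (j, m) \<in> r"
  using assms(2-)
proof (induction t rule: finite_ne_induct)
  case (singleton x)
  then show ?case using assms(1)
    by (auto simp: order_on_defs refl_on_def)
next
  case (insert x t)
  then obtain m where m: "m \<in> t" "\<forall>j\<in>t. (j, m) \<in> r" by auto
  have "(x, m) \<in> r \<or> (m, x) \<in> r" "(x, x) \<in> r"
    using assms(1) insert.prems m(1) insert.hyps by (auto 0 3 simp: order_on_defs refl_on_def total_on_def)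
  moreover have "trans r" using assms(1) by (auto simp: order_on_defs)
  ultimately show ?case using m by (metis (no_types, lifting) insert_iff transD)
qed

section \<open>The Erdos-Rado theorem for sets of a fixed finite size\<close>

section \<open>Homogeneous sets\<close>

text \<open>In the proof, \<open>y x i\<close> realises the same colours over its predecessors \<open>y x j\<close> as \<open>x\<close> does, and it
  is chosen from these colours alone. An \<open>x\<close> that occurs in its own sequence is therefore determined
  by its position and by \<open>\<theta>\<close> many colours, and \<open>X\<close> is too large for this to happen to every \<open>x\<close>.\<close>

lemma end_homogeneous:
  fixes F :: "'a set \<Rightarrow> 'c" and \<theta> :: "'t rel"
  assumes \<theta>: "Cinfinite \<theta>"
    and Col: "range F \<subseteq> Col" "|Col| \<le>o ctwo ^c \<theta>"
    and X: "ctwo ^c \<theta> <o |X|"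
  shows "\<exists>Y\<subseteq>X. \<theta> \<le>o |Y| \<and> (\<exists>F'. range F' \<subseteq> Col \<and>
    (\<forall>s. finite s \<and> s \<subseteq> Y \<and> s \<noteq> {} \<longrightarrow> (\<exists>z\<in>s. F s = F' (s - {z}))))"
proof -
  define h where "h = (\<lambda>B p. SOME z. z \<in> X - B \<and> (\<forall>s. finite s \<and> s \<subseteq> B \<longrightarrow> F (insert z s) = p s))"
  define y where "y = (\<lambda>x. wfrec (\<theta> - Id) (\<lambda>f i. h (f ` underS \<theta> i) (\<lambda>s. F (insert x s))))"
  have wo: "Well_order \<theta>" using \<theta> by (auto simp: card_order_on_def)
  note WF = wo_rel.WF[unfolded wo_rel_def, OF wo] and LIN = wo_rel.LIN[unfolded wo_rel_def, OF wo]
    and TOTALS = wo_rel.TOTALS[unfolded wo_rel_def, OF wo]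
    and well_order_induct = wo_rel.well_order_induct[unfolded wo_rel_def, OF wo]
  have y: "y x i = h (y x ` underS \<theta> i) (\<lambda>s. F (insert x s))" for x i
  proof -
    have "cut (y x) (\<theta> - Id) i ` underS \<theta> i = y x ` underS \<theta> i"
      by (rule image_cong) (auto simp: cut_def underS_def)
    moreover have "y x i = h (cut (y x) (\<theta> - Id) i ` underS \<theta> i) (\<lambda>s. F (insert x s))"
      unfolding y_def by (subst wfrec[OF WF]) (rule refl)
    ultimately show ?thesis by simp
  qed
  have yX: "y x i \<in> X - y x ` underS \<theta> i \<and>
      (\<forall>s. finite s \<and> s \<subseteq> y x ` underS \<theta> i \<longrightarrow> F (insert (y x i) s) = F (insert x s))"
    if "x \<in> X" "x \<notin> y x ` underS \<theta> i" for x i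
  proof -
    let ?P = "\<lambda>z. z \<in> X - y x ` underS \<theta> i \<and>
      (\<forall>s. finite s \<and> s \<subseteq> y x ` underS \<theta> i \<longrightarrow> F (insert z s) = F (insert x s))"
    have "y x i = Eps ?P" by (subst y) (simp add: h_def)
    moreover have "?P (Eps ?P)" by (rule someI[of ?P x]) (use that in auto)
    ultimately show ?thesis by simp
  qed
  have "\<exists>x\<in>X. x \<notin> y x ` Field \<theta>"
  proof (rule ccontr)
    assume "\<not> ?thesis"
    hence "\<forall>x\<in>X. \<exists>i\<in>Field \<theta>. x = y x i" by auto
    then obtain ix where ix: "\<And>x. x \<in> X \<Longrightarrow> ix x \<in> Field \<theta> \<and> x = y x (ix x)" by metis
    \<comment> \<open>Colours are recorded at lists of positions, not at sets of elements, so that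
      different \<open>x\<close> can be compared before their sequences are known to agree. The
      value \<open>undefined\<close> elsewhere puts the record into \<open>Func\<close>, whose
      cardinal is a power.\<close>
    define pat where "pat = (\<lambda>x l. if l \<in> lists (Field \<theta>) then F (insert x (y x ` set l)) else undefined)"
    have "inj_on (\<lambda>x. (ix x, pat x)) X"
    proof (rule inj_onI)
      fix x x' assume x: "x \<in> X" "x' \<in> X" and eq: "(ix x, pat x) = (ix x', pat x')"
      have "y x j = y x' j" for j
      proof (induction j rule: well_order_induct)
        case (1 j)
        hence img: "y x ` underS \<theta> j = y x' ` underS \<theta> j"
          by (intro image_cong) (auto simp: underS_def)
        have "F (insert x s) = F (insert x' s)" if s: "finite s" "s \<subseteq> y x ` underS \<theta> j" for s
        proof -
          obtain t where t: "t \<subseteq> underS \<theta> j" "finite t" "s = y x ` t"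
            using s finite_subset_image by metis
          obtain l where l: "set l = t" using t(2) finite_list by auto
          have "l \<in> lists (Field \<theta>)" using l t(1) by (auto simp: underS_def Field_def)
          moreover have "y x ` t = y x' ` t"
            using t(1) 1 by (intro image_cong) (auto simp: underS_def)
          moreover have "pat x l = pat x' l" using eq by simp
          ultimately show ?thesis by (simp add: pat_def l t(3))
        qed
        thus ?case unfolding y[of x j] y[of x' j] img h_def
          by (intro arg_cong[of _ _ Eps] ext) (auto simp: img)
      qed
      thus "x = x'" using ix[OF x(1)] ix[OF x(2)] eq by simp
    qed
    moreover {
      have "pat x \<in> Func (lists (Field \<theta>)) Col" for x
      using Col(1) by (simp add: pat_def Func_def image_subset_iff del: in_lists_conv_set)
      hence "(\<lambda>x. (ix x, pat x)) ` X \<subseteq> Field \<theta> \<times> Func (lists (Field \<theta>)) Col"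
        using ix by auto
    }
    ultimately have "|X| \<le>o |Field \<theta> \<times> Func (lists (Field \<theta>)) Col|"
      unfolding card_of_ordLeq[symmetric] by blast
    also have "|Field \<theta> \<times> Func (lists (Field \<theta>)) Col| \<le>o ctwo ^c \<theta>"
    proof -
      have inf: "Cinfinite (ctwo ^c \<theta>)" using \<theta> by (simp add: Cinfinite_cexp ordLeq_refl Card_order_ctwo)
      have "|Col| ^c |lists (Field \<theta>)| \<le>o (ctwo ^c \<theta>) ^c \<theta>"
      proof (rule cexp_mono)
        show "|Col| \<le>o ctwo ^c \<theta>" by fact
        show "|lists (Field \<theta>)| \<le>o \<theta>"
          using \<theta> by (intro Card_order_lists_le) (auto simp: card_of_Field_ordIso ordIso_imp_ordLeq)
        have "lists (Field \<theta>) \<noteq> {}" by blast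
        then show "|lists (Field \<theta>)| =o (czero :: 't rel) \<Longrightarrow> \<theta> =o (czero :: 't rel)"
          by (simp add: card_of_ordIso_czero_iff_empty)
      qed (rule card_of_Card_order)
      also have "(ctwo ^c \<theta>) ^c \<theta> =o ctwo ^c (\<theta> *c \<theta>)"
        using \<theta> by (intro cexp_cprod) (simp add: Card_order_ctwo)
      also have "ctwo ^c (\<theta> *c \<theta>) =o ctwo ^c \<theta>"
        using \<theta> by (intro cexp_cong2) (auto simp: cprod_infinite Card_order_ctwo Card_order_cprod)
      finally have "|Func (lists (Field \<theta>)) Col| \<le>o ctwo ^c \<theta>"
        by (simp add: cexp_def Field_card_of)
      moreover have "|Field \<theta>| \<le>o ctwo ^c \<theta>"
        using \<theta> card_of_Field_ordIso ordLess_ctwo_cexp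
        by (meson ordIso_ordLeq_trans ordLess_imp_ordLeq)
      ultimately show ?thesis using inf
        by (intro card_of_Times_ordLeq_infinite_Field) (auto simp: cinfinite_def)
    qed
    finally show False using X not_ordLess_ordLeq by blast
  qed
  then obtain x where x: "x \<in> X" "x \<notin> y x ` Field \<theta>" by auto
  have ys: "y x i \<in> X - y x ` underS \<theta> i"
    "\<And>s. finite s \<Longrightarrow> s \<subseteq> y x ` underS \<theta> i \<Longrightarrow> F (insert (y x i) s) = F (insert x s)" if "i \<in> Field \<theta>" for i
    using yX[of x i] x that by (auto simp: underS_def Field_def)
  have inj: "inj_on (y x) (Field \<theta>)"
  proof (rule inj_onI, rule ccontr)
    fix i j assume ij: "i \<in> Field \<theta>" "j \<in> Field \<theta>" "y x i = y x j" "i \<noteq> j"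
    hence "i \<in> underS \<theta> j \<or> j \<in> underS \<theta> i" using TOTALS by (auto simp: underS_def)
    thus False using ys(1)[OF ij(1)] ys(1)[OF ij(2)] ij(3) by (metis DiffD2 imageI)
  qed
  show ?thesis
  proof (intro exI[of _ "y x ` Field \<theta>"] conjI exI[of _ "\<lambda>s. F (insert x s)"] allI impI)
    show "y x ` Field \<theta> \<subseteq> X" using ys(1) by auto
    have "\<theta> =o |Field \<theta>|" using \<theta> by (simp add: card_of_Field_ordIso ordIso_symmetric)
    also have "|Field \<theta>| =o |y x ` Field \<theta>|"
      using inj card_of_ordIso inj_on_imp_bij_betw by blast
    finally show "\<theta> \<le>o |y x ` Field \<theta>|" by (rule ordIso_imp_ordLeq)
    show "range (\<lambda>s. F (insert x s)) \<subseteq> Col" using Col(1) by auto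
    fix s assume s: "finite s \<and> s \<subseteq> y x ` Field \<theta> \<and> s \<noteq> {}"
    then obtain t where t: "t \<subseteq> Field \<theta>" "finite t" "s = y x ` t" using finite_subset_image by metis
    then obtain m where m: "m \<in> t" "\<forall>j\<in>t. (j, m) \<in> \<theta>"
      using Linear_order_finite_max[OF LIN, of t] s by auto
    \<comment> \<open>The element to drop is the one in the last position: over the earlier ones it
      has the same colours as \<open>x\<close>.\<close>
    have "s - {y x m} \<subseteq> y x ` underS \<theta> m" using t m by (auto simp: underS_def)
    hence "F (insert (y x m) (s - {y x m})) = F (insert x (s - {y x m}))"
      using ys(2)[of m "s - {y x m}"] m t s by auto
    moreover have "y x m \<in> s" using m t by simp
    ultimately show "\<exists>z\<in>s. F s = F (insert x (s - {z}))" by (metis insert_Diff)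
  qed
qed

text \<open>One use of \<open>end_homogeneous\<close> costs one exponential and turns a colouring of
  sets of size \<open>Suc n\<close> into one of sets of size \<open>n\<close> with values in the
  same \<open>Col\<close>, so a tower of \<open>n\<close> exponentials pays for size
  \<open>n\<close>. The result keeps size \<open>\<theta> 0\<close>, instead of being merely
  infinite, because the next size is treated inside it in
  \<open>homogeneous_below_beth\<close>.\<close>

lemma homogeneous:
  fixes F :: "'a set \<Rightarrow> 'c" and \<theta> :: "nat \<Rightarrow> 't rel"
  assumes \<theta>: "\<And>m. Cinfinite (\<theta> m)" "\<And>m. ctwo ^c \<theta> m <o \<theta> (Suc m)"
    and "range F \<subseteq> Col" "|Col| \<le>o \<theta> 0" "\<theta> n \<le>o |X|"
  shows "\<exists>Y\<subseteq>X. \<theta> 0 \<le>o |Y| \<and> (\<exists>c. \<forall>s. finite s \<and> s \<subseteq> Y \<and> card s = n \<longrightarrow> F s = c)"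
  using assms(3-)
proof (induction n arbitrary: F X)
  case 0
  then show ?case by (intro exI[of _ X]) auto
next
  case (Suc n)
  have less: "\<theta> m <o \<theta> (Suc m)" for m
    using \<theta> ordLess_ctwo_cexp ordLess_transitive by blast
  have "\<theta> 0 \<le>o \<theta> m" for m
    by (induction m) (use \<theta>(1) less in \<open>auto intro: ordLeq_refl ordLess_imp_ordLeq ordLeq_ordLess_trans\<close>)
  moreover have "\<theta> n \<le>o ctwo ^c \<theta> n" using \<theta>(1) ordLess_ctwo_cexp ordLess_imp_ordLeq by blast
  ultimately have "|Col| \<le>o ctwo ^c \<theta> n" using Suc.prems(2) by (meson ordLeq_transitive)
  moreover have "ctwo ^c \<theta> n <o |X|" using \<theta>(2) Suc.prems(3) by (rule ordLess_ordLeq_trans)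
  ultimately obtain Y F' where Y: "Y \<subseteq> X" "\<theta> n \<le>o |Y|" "range F' \<subseteq> Col"
    and F': "\<And>s. finite s \<Longrightarrow> s \<subseteq> Y \<Longrightarrow> s \<noteq> {} \<Longrightarrow> \<exists>z\<in>s. F s = F' (s - {z})"
    using end_homogeneous[OF \<theta>(1) Suc.prems(1)] by metis
  obtain Z c where Z: "Z \<subseteq> Y" "\<theta> 0 \<le>o |Z|" "\<forall>s. finite s \<and> s \<subseteq> Z \<and> card s = n \<longrightarrow> F' s = c"
    using Suc.IH[OF Y(3) Suc.prems(2) Y(2)] by metis
  have "F s = c" if s: "finite s" "s \<subseteq> Z" "card s = Suc n" for s
  proof -
    obtain z where "z \<in> s" "F s = F' (s - {z})" using F'[of s] s Z(1) by force
    moreover have "finite (s - {z})" "s - {z} \<subseteq> Z" using s by auto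
    ultimately show ?thesis using Z(3) s by auto
  qed
  thus ?case using Z(1,2) Y(1) by (intro exI[of _ Z]) auto
qed

section \<open>Choice of colours for all finite sizes at once\<close>

section \<open>Homogeneity below a beth number\<close>

text \<open>An arbitrary initial segment \<open>J\<close> lets this serve twice: for
  \<open>underS r j\<close> within the induction, and for \<open>Field r\<close>, where
  \<open>c\<close> is the beth number itself. If \<open>J\<close> has a last element
  \<open>k\<close>, then \<open>c\<close> is the power of \<open>|B k|\<close>, which bounds the
  earlier powers; otherwise some later index already bounds the power of
  \<open>|B i|\<close>.\<close>

lemma beth_step_growth:
  assumes wo: "Well_order r" and J: "wo_rel.ofilter r J"
    and step: "beth_step r J B c"
    and IH: "\<And>i j. j \<in> J \<Longrightarrow> i \<in> underS r j \<Longrightarrow> ctwo ^c |B i| \<le>o |B j|"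
    and c: "Card_order c" and i: "i \<in> J"
  shows "ctwo ^c |B i| \<le>o c"
proof -
  have JF: "J \<subseteq> Field r" using J wo unfolding wo_rel.ofilter_def[unfolded wo_rel_def, OF wo] by simp
  note TOTALS = wo_rel.TOTALS[unfolded wo_rel_def, OF wo]
  have step': "\<And>j. j \<in> J \<Longrightarrow> J \<subseteq> under r j \<Longrightarrow> c =o ctwo ^c |B j|"
    "(\<And>j. j \<in> J \<Longrightarrow> \<not> J \<subseteq> under r j) \<Longrightarrow> j \<in> J \<Longrightarrow> |B j| \<le>o c" for j
    using step i unfolding beth_step_def by blast+
  show ?thesis
  proof (cases "\<exists>k\<in>J. J \<subseteq> under r k")
    case True
    then obtain k where k: "k \<in> J" "J \<subseteq> under r k" by auto
    have ck: "ctwo ^c |B k| =o c" using step'(1)[OF k] by (rule ordIso_symmetric)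
    show ?thesis
    proof (cases "i = k")
      case True
      then show ?thesis using ck by (auto intro: ordIso_imp_ordLeq)
    next
      case False
      hence "i \<in> underS r k" using k i by (auto simp: under_def underS_def)
      hence "ctwo ^c |B i| \<le>o |B k|" using IH k(1) by auto
      moreover have "|B k| \<le>o ctwo ^c |B k|"
        by (intro ordLess_imp_ordLeq ordLess_ctwo_cexp card_of_Card_order)
      ultimately show ?thesis using ck by (meson ordLeq_transitive ordLeq_ordIso_trans)
    qed
  next
    case False
    then obtain k where k: "k \<in> J" "(k, i) \<notin> r" using i by (auto simp: under_def)
    hence "i \<in> underS r k" using TOTALS JF i by (auto simp: underS_def)
    hence "ctwo ^c |B i| \<le>o |B k|" using IH k(1) by auto
    moreover have "|B k| \<le>o c" using step'(2) False k(1) by blast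
    ultimately show ?thesis by (rule ordLeq_transitive)
  qed
qed

lemma is_bethE:
  fixes r :: "'o rel" and l :: "'l rel"
  assumes "is_beth r l"
  obtains B :: "'o \<Rightarrow> 'l set"
  where "\<And>i j. j \<in> Field r \<Longrightarrow> i \<in> underS r j \<Longrightarrow> ctwo ^c |B i| \<le>o |B j|"
    and "\<And>i. i \<in> Field r \<Longrightarrow> ctwo ^c |B i| \<le>o l"
    and "\<And>i. i \<in> Field r \<Longrightarrow> infinite (B i)"
proof -
  from assms obtain B :: "'o \<Rightarrow> 'l set" where wo: "Well_order r" and l: "Card_order l"
    and B: "\<And>i. i \<in> Field r \<Longrightarrow> beth_step r (underS r i) B |B i|" "beth_step r (Field r) B l"
    unfolding is_beth_def by blast
  interpret R: wo_rel r using wo by (simp add: wo_rel_def)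
  have mono: "ctwo ^c |B i| \<le>o |B j|" if "j \<in> Field r" "i \<in> underS r j" for i j
    using that
  proof (induction j arbitrary: i rule: R.well_order_induct)
    case (1 j)
    show ?case
    proof (rule beth_step_growth[OF wo _ B(1)[OF 1(2)] _ card_of_Card_order 1(3)])
      show "R.ofilter (underS r j)" by (rule R.underS_ofilter)
      show "ctwo ^c |B i'| \<le>o |B j'|" if "j' \<in> underS r j" "i' \<in> underS r j'" for i' j'
        using 1(1)[rule_format, of j' i'] that by (auto simp: underS_def Field_def)
    qed
  qed
  moreover have "ctwo ^c |B i| \<le>o l" if "i \<in> Field r" for i
    by (rule beth_step_growth[OF wo R.Field_ofilter B(2) mono l that])
  moreover have "infinite (B i)" if i: "i \<in> Field r" for i
  proof -
    obtain z where z: "z \<in> Field r" "\<And>j. j \<in> Field r \<Longrightarrow> (z, j) \<in> r"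
      using R.minim_in[of "Field r"] R.minim_least[of "Field r"] i by blast
    have "underS r z = {}"
      using z R.ANTISYM by (auto simp: underS_def antisym_def Field_def)
    hence "|B z| =o natLeq" using B(1)[OF z(1)] by (simp add: beth_step_def)
    hence inf: "infinite (B z)"
      using infinite_iff_natLeq_ordLeq ordIso_iff_ordLeq by blast
    show ?thesis
    proof (cases "i = z")
      case False
      hence "ctwo ^c |B z| \<le>o |B i|" using mono[OF i] z(2)[OF i] by (auto simp: underS_def)
      moreover have "|B z| \<le>o ctwo ^c |B z|"
        by (intro ordLess_imp_ordLeq ordLess_ctwo_cexp card_of_Card_order)
      ultimately show ?thesis using inf card_of_ordLeq_infinite ordLeq_transitive by metis
    qed (use inf in simp)
  qed
  ultimately show ?thesis by (rule that)
qed

text \<open>The set \<open>Y\<close> may change with \<open>n\<close>, but the colours may not. So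
  the colours are fixed one size at a time while sets of every size \<open>|B i|\<close> stay
  available; this is the invariant \<open>good\<close>. Suppose no colour \<open>x\<close> extends
  the list, and let \<open>ib x\<close> be an index where it fails. By regularity of
  \<open>cardSuc \<tau>\<close> these indices have a bound \<open>m\<close>, and a homogeneous set
  of size at least \<open>|B m|\<close> yields a colour that does not fail.\<close>

lemma homogeneous_below_beth:
  fixes F :: "'l set \<Rightarrow> 'c" and \<tau> :: "'t rel" and lam :: "'l rel"
  assumes beth: "is_beth (cardSuc \<tau>) lam" and \<tau>: "Cinfinite \<tau>"
    and F: "range F \<subseteq> Col" and Col: "|Col| \<le>o \<tau>"
  shows "\<exists>c. \<forall>n. \<exists>Y\<subseteq>Field lam. infinite Y \<and> (\<forall>s\<subseteq>Y. finite s \<and> card s < n \<longrightarrow> F s = c (card s))"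
proof -
  let ?r = "cardSuc \<tau>"
  obtain B :: "'t set \<Rightarrow> 'l set"
    where mono: "\<And>i j. j \<in> Field ?r \<Longrightarrow> i \<in> underS ?r j \<Longrightarrow> ctwo ^c |B i| \<le>o |B j|"
    and le_lam: "\<And>i. i \<in> Field ?r \<Longrightarrow> ctwo ^c |B i| \<le>o lam"
    and inf: "\<And>i. i \<in> Field ?r \<Longrightarrow> infinite (B i)"
    using is_bethE[OF beth] by blast
  have r: "Cinfinite ?r" using \<tau> by (rule Cinfinite_cardSuc)
  have wo: "Well_order ?r" using beth by (simp add: is_beth_def)
  interpret R: wo_rel ?r using wo by (simp add: wo_rel_def)
  have less: "|B i| <o |B j|" if "j \<in> Field ?r" "i \<in> underS ?r j" for i j
    using mono[OF that] ordLess_ctwo_cexp[OF card_of_Card_order] by (rule ordLess_ordLeq_trans[rotated])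
  have leq: "|B i| \<le>o |B j|" if "(i, j) \<in> ?r" for i j
  proof (cases "i = j")
    case False
    then show ?thesis using less[of j i] that by (auto simp: underS_def Field_def intro: ordLess_imp_ordLeq)
  qed (simp add: card_of_refl ordIso_imp_ordLeq)
  have lim: "\<exists>j\<in>Field ?r. i \<in> underS ?r j" if "i \<in> Field ?r" for i
    using infinite_Card_order_limit[of ?r i] r that
    by (auto simp: cinfinite_def underS_def Field_def)
  \<comment> \<open>Going up twice makes the growth strict, as \<open>homogeneous\<close>
    requires.\<close>
  have "\<exists>j\<in>Field ?r. ctwo ^c |B i| <o |B j|" if "i \<in> Field ?r" for i
    using lim[OF that] lim mono less by (metis ordLeq_ordLess_trans)
  then obtain nx where nx: "\<And>i. i \<in> Field ?r \<Longrightarrow> nx i \<in> Field ?r \<and> ctwo ^c |B i| <o |B (nx i)|"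
    by metis
  obtain i0 where i0: "i0 \<in> Field ?r" "\<tau> \<le>o |B i0|"
  proof -
    obtain i0 where i0: "i0 \<in> Field ?r" "\<tau> =o Restr ?r (underS ?r i0)"
      using cardSuc_greater[of \<tau>] \<tau> ordLess_iff_ordIso_Restr[of ?r \<tau>] wo
      by (auto simp: card_order_on_def)
    \<comment> \<open>\<open>i0\<close> has \<tau> predecessors, and their sets \<open>B j\<close>
      have distinct cardinals below \<open>|B i0|\<close>. As well-orders these are distinct initial
      segments of \<open>|B i0|\<close>, and the end points \<open>b j\<close> inject the
      predecessors into \<open>B i0\<close>.\<close>
    have "\<exists>b\<in>B i0. |B j| =o Restr |B i0| (underS |B i0| b)" if "j \<in> underS ?r i0" for j
      using less[OF i0(1) that] ordLess_iff_ordIso_Restr[of "|B i0|" "|B j|"]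
      by (simp add: card_of_well_order_on Field_card_of)
    then obtain b where b: "\<And>j. j \<in> underS ?r i0 \<Longrightarrow> b j \<in> B i0"
        "\<And>j. j \<in> underS ?r i0 \<Longrightarrow> |B j| =o Restr |B i0| (underS |B i0| (b j))" by metis
    have "inj_on b (underS ?r i0)"
    proof (rule inj_onI, rule ccontr)
      fix j k assume jk: "j \<in> underS ?r i0" "k \<in> underS ?r i0" "b j = b k" "j \<noteq> k"
      hence iso: "|B j| =o |B k|" using b(2) by (metis ordIso_symmetric ordIso_transitive)
      have F: "j \<in> Field ?r" "k \<in> Field ?r" using jk by (auto simp: underS_def Field_def)
      have "(j, k) \<in> ?r \<or> (k, j) \<in> ?r" using R.TOTALS F by blast
      hence "|B j| <o |B k| \<or> |B k| <o |B j|" using less F jk(4) by (auto simp: underS_def)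
      thus False using iso not_ordLess_ordIso ordIso_symmetric by blast
    qed
    hence "|underS ?r i0| \<le>o |B i0|" using b(1) by (intro card_of_ordLeqI) auto
    moreover have "\<tau> \<le>o |underS ?r i0|"
    proof -
      have "\<tau> =o |Field \<tau>|" using \<tau> card_of_Field_ordIso ordIso_symmetric by blast
      also have "|Field \<tau>| =o |Field (Restr ?r (underS ?r i0))|" using i0(2) by (rule card_of_cong)
      also have "Field (Restr ?r (underS ?r i0)) = underS ?r i0"
        using R.underS_ofilter Field_Restr_ofilter[OF wo] by blast
      finally show ?thesis by (rule ordIso_imp_ordLeq)
    qed
    ultimately show ?thesis using that[OF i0(1)] ordLeq_transitive by metis
  qed
  define good where "good = (\<lambda>cs i. \<exists>Y\<subseteq>Field lam. |B i| \<le>o |Y| \<and>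
    (\<forall>s\<subseteq>Y. finite s \<and> card s < length cs \<longrightarrow> F s = cs ! card s))"
  have extend: "\<exists>x. \<forall>i\<in>Field ?r. good (cs @ [x]) i" if cs: "\<forall>i\<in>Field ?r. good cs i" for cs
  proof (rule ccontr)
    assume "\<not> ?thesis"
    then obtain ib where ib: "\<And>x. ib x \<in> Field ?r" "\<And>x. \<not> good (cs @ [x]) (ib x)" by metis
    \<comment> \<open>With \<open>i0\<close> included, the bound \<open>m\<close> also satisfies
      \<open>|Col| \<le>o |B m|\<close>, the condition on the base of the tower in
      \<open>homogeneous\<close>.\<close>
    let ?K = "insert i0 (ib ` Col)"
    have "|?K| <o ?r"
    proof -
      have "|{i0} \<union> ib ` Col| \<le>o \<tau>"
      proof (rule Un_Cinfinite_bound[OF _ _ \<tau>])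
        show "|{i0}| \<le>o \<tau>" using \<tau> by (intro Card_order_singl_ordLeq) (auto simp: cinfinite_def)
        show "|ib ` Col| \<le>o \<tau>" using Col card_of_image ordLeq_transitive by metis
      qed
      thus ?thesis using cardSuc_greater \<tau> by (auto intro: ordLeq_ordLess_trans)
    qed
    hence "\<not> |?K| =o ?r" by (rule not_ordLess_ordIso)
    moreover have "?K \<subseteq> Field ?r" using ib i0 by auto
    ultimately have "\<not> cofinal ?K ?r"
      using regularCard_cardSuc[OF \<tau>] unfolding regularCard_def by blast
    then obtain m where m: "m \<in> Field ?r" "\<And>k. k \<in> ?K \<Longrightarrow> (k, m) \<in> ?r"
      using \<open>?K \<subseteq> Field ?r\<close> R.TOTALS unfolding cofinal_def by (metis subsetD)
    let ?\<theta> = "\<lambda>k. |B ((nx ^^ k) m)|"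
    have nxm: "(nx ^^ k) m \<in> Field ?r" for k by (induction k) (use m nx in auto)
    have "good cs ((nx ^^ length cs) m)" using cs nxm by blast
    then obtain Y where Y: "Y \<subseteq> Field lam" "?\<theta> (length cs) \<le>o |Y|"
      "\<And>s. s \<subseteq> Y \<Longrightarrow> finite s \<Longrightarrow> card s < length cs \<Longrightarrow> F s = cs ! card s"
      unfolding good_def by metis
    have "|Col| \<le>o ?\<theta> 0"
    proof -
      have "|Col| \<le>o |B i0|" using Col i0(2) by (rule ordLeq_transitive)
      moreover have "|B i0| \<le>o |B m|" using m(2) leq by simp
      ultimately show ?thesis by (simp add: ordLeq_transitive[of _ "|B i0|"])
    qed
    hence "\<exists>Z\<subseteq>Y. ?\<theta> 0 \<le>o |Z| \<and> (\<exists>c. \<forall>s. finite s \<and> s \<subseteq> Z \<and> card s = length cs \<longrightarrow> F s = c)"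
      by (intro homogeneous[of ?\<theta> F Col "length cs" Y] F Y(2))
        (use nxm nx inf in \<open>auto simp: cinfinite_def Field_card_of card_of_card_order_on\<close>)
    then obtain Z x where Z: "Z \<subseteq> Y" "?\<theta> 0 \<le>o |Z|"
        "\<And>s. finite s \<Longrightarrow> s \<subseteq> Z \<Longrightarrow> card s = length cs \<Longrightarrow> F s = x"
      by metis
    \<comment> \<open>Sets of size \<open>length cs\<close> exist in \<open>Z\<close>, so
      \<open>x\<close> is a colour that really occurs. Hence \<open>x \<in> Col\<close>, and
      \<open>ib x\<close> lies below \<open>m\<close>.\<close>
    have "infinite Z" using Z(2) inf[OF m(1)] card_of_ordLeq_infinite by auto
    then obtain s where "s \<subseteq> Z" "finite s" "card s = length cs"
      using infinite_arbitrarily_large by blast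
    hence "x \<in> Col" using Z(3)[of s] F by auto
    hence "|B (ib x)| \<le>o |B m|" using m(2)[of "ib x"] leq by simp
    moreover have "|B m| \<le>o |Z|" using Z(2) by simp
    ultimately have "|B (ib x)| \<le>o |Z|" by (rule ordLeq_transitive)
    hence "good (cs @ [x]) (ib x)" unfolding good_def using Z(1,3) Y(1,3)
      by (intro exI[of _ Z]) (auto simp: nth_append less_Suc_eq)
    thus False using ib(2) by blast
  qed
  define ext where "ext = (\<lambda>cs. cs @ [SOME x. \<forall>i\<in>Field ?r. good (cs @ [x]) i])"
  define cs where "cs = (\<lambda>n. (ext ^^ n) [])"
  have good: "\<forall>i\<in>Field ?r. good (cs n) i" for n
  proof (induction n)
    case 0
    have "|B i| \<le>o |Field lam|" if "i \<in> Field ?r" for i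
    proof -
      have "|B i| \<le>o ctwo ^c |B i|" by (intro ordLess_imp_ordLeq ordLess_ctwo_cexp card_of_Card_order)
      moreover have "lam =o |Field lam|"
        using beth card_of_Field_ordIso ordIso_symmetric unfolding is_beth_def by blast
      ultimately show ?thesis using le_lam[OF that] by (meson ordLeq_transitive ordLeq_ordIso_trans)
    qed
    then show ?case unfolding good_def cs_def by auto
  next
    case (Suc n)
    show ?case using someI_ex[OF extend[OF Suc]] by (simp add: cs_def ext_def)
  qed
  have len: "length (cs n) = n" for n by (induction n) (auto simp: cs_def ext_def)
  have nth: "k < n \<Longrightarrow> cs n ! k = cs (Suc k) ! k" for k n
  proof (induction n)
    case (Suc n)
    have "cs (Suc n) ! k = cs n ! k" if "k < n" using that len[of n] by (simp add: cs_def ext_def nth_append)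
    then show ?case using Suc by (cases "k = n") auto
  qed simp
  show ?thesis
  proof (intro exI[of _ "\<lambda>k. cs (Suc k) ! k"] allI)
    fix n
    have "good (cs n) i0" using good i0(1) by blast
    then obtain Y where Y: "Y \<subseteq> Field lam" "|B i0| \<le>o |Y|"
        "\<forall>s\<subseteq>Y. finite s \<and> card s < n \<longrightarrow> F s = cs n ! card s"
      unfolding good_def len by metis
    moreover have "infinite Y" using Y(2) inf[OF i0(1)] by (rule card_of_ordLeq_infinite)
    ultimately show "\<exists>Y\<subseteq>Field lam. infinite Y \<and> (\<forall>s\<subseteq>Y. finite s \<and> card s < n \<longrightarrow> F s = cs (Suc (card s)) ! card s)"
      using nth by (metis (no_types, lifting))
  qed
qed

section \<open>Ultrafilters\<close>

lemma ultrafilter_exists: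
  fixes F0 :: "'a filter"
  assumes "F0 \<noteq> bot"
  obtains U where "U \<le> F0" "U \<noteq> bot" "\<And>P. eventually P U \<or> eventually (\<lambda>x. \<not> P x) U"
proof -
  let ?A = "{F. F \<le> F0 \<and> F \<noteq> bot}"
  have "\<exists>m\<in>?A. \<forall>a\<in>?A. a \<le> m \<longrightarrow> a = m"
  proof (rule predicate_Zorn[of ?A "\<lambda>a b. b \<le> a"])
    show "partial_order_on ?A (relation_of (\<lambda>a b. b \<le> a) ?A)"
      by (auto simp: order_on_defs refl_on_def trans_def antisym_def relation_of_def)
    fix C assume C: "C \<in> Chains (relation_of (\<lambda>a b. b \<le> a) ?A)"
    show "\<exists>u\<in>?A. \<forall>a\<in>C. u \<le> a"
    proof (cases "C = {}")
      case True
      then show ?thesis using assms by auto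
    next
      case False
      have CA: "C \<subseteq> ?A" and lin: "\<And>F G. F \<in> C \<Longrightarrow> G \<in> C \<Longrightarrow> F \<le> G \<or> G \<le> F"
        using C by (auto simp: Chains_def relation_of_def)
      have "eventually P (Inf C) \<longleftrightarrow> (\<exists>b\<in>C. eventually P b)" for P
        by (rule eventually_Inf_base[OF False]) (metis lin inf.absorb1 inf.absorb2 order_refl)
      hence "Inf C \<noteq> bot" using CA unfolding trivial_limit_def by blast
      moreover have "Inf C \<le> F0" using False CA by (auto intro: Inf_lower2)
      ultimately show ?thesis by (intro bexI[of _ "Inf C"]) (auto intro: Inf_lower)
    qed
  qed
  then obtain U where U: "U \<le> F0" "U \<noteq> bot" and max: "\<And>a. a \<le> F0 \<Longrightarrow> a \<noteq> bot \<Longrightarrow> a \<le> U \<Longrightarrow> a = U"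
    by blast
  have "eventually P U \<or> eventually (\<lambda>x. \<not> P x) U" for P
  proof (cases "inf U (principal {x. P x}) = bot")
    case True
    hence "eventually (\<lambda>x. \<not> P x) U"
      unfolding trivial_limit_def by (simp add: eventually_inf_principal)
    then show ?thesis ..
  next
    case False
    hence "inf U (principal {x. P x}) = U" using U(1) by (intro max) (auto intro: le_infI1)
    hence "U \<le> principal {x. P x}" by (metis inf_le2)
    then show ?thesis by (simp add: le_principal)
  qed
  then show ?thesis using that U by blast
qed

section \<open>Terms and formulas\<close>

text \<open>Valuations and substitutions are total on \<open>nat\<close>, so finiteness of support
  has to be extracted. A crude bound suffices: values below it determine the truth of the formula,
  and the variables from it on are fresh.\<close>

fun tm_bound :: "'f tm \<Rightarrow> nat" where
  "tm_bound (Var n) = Suc n"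
| "tm_bound (Fn f ts) = sum_list (map tm_bound ts)"

fun fm_bound :: "('f, 'r) fm \<Rightarrow> nat" where
  "fm_bound Top = 0"
| "fm_bound Bot = 0"
| "fm_bound (Eq s t) = tm_bound s + tm_bound t"
| "fm_bound (Rel R ts) = sum_list (map tm_bound ts)"
| "fm_bound (Conj \<phi> \<psi>) = fm_bound \<phi> + fm_bound \<psi>"
| "fm_bound (Disj \<phi> \<psi>) = fm_bound \<phi> + fm_bound \<psi>"
| "fm_bound (Ex n \<phi>) = fm_bound \<phi>"

lemma val_cong: "(\<And>i. i < tm_bound t \<Longrightarrow> v i = w i) \<Longrightarrow> val M v t = val M w t"
proof (induction t)
  case (Fn f ts)
  have "val M v t = val M w t" if "t \<in> set ts" for t
    using that Fn.IH[OF that] Fn.prems member_le_sum_list[of "tm_bound t" "map tm_bound ts"] by auto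
  then show ?case by (simp cong: map_cong)
qed simp

lemma holds_cong: "(\<And>i. i < fm_bound \<phi> \<Longrightarrow> v i = w i) \<Longrightarrow> holds M v \<phi> \<longleftrightarrow> holds M w \<phi>"
proof (induction \<phi> arbitrary: v w)
  case (Eq s t)
  have "val M v s = val M w s" "val M v t = val M w t" using Eq by (auto intro!: val_cong)
  then show ?case by simp
next
  case (Rel R ts)
  have "val M v t = val M w t" if "t \<in> set ts" for t
    using that Rel.prems member_le_sum_list[of "tm_bound t" "map tm_bound ts"]
    by (intro val_cong) auto
  then show ?case by (simp cong: map_cong)
next
  case (Conj \<phi> \<psi>)
  have "holds M v \<phi> \<longleftrightarrow> holds M w \<phi>" "holds M v \<psi> \<longleftrightarrow> holds M w \<psi>"
    by (rule Conj.IH; simp add: Conj.prems)+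
  then show ?case by simp
next
  case (Disj \<phi> \<psi>)
  have "holds M v \<phi> \<longleftrightarrow> holds M w \<phi>" "holds M v \<psi> \<longleftrightarrow> holds M w \<psi>"
    by (rule Disj.IH; simp add: Disj.prems)+
  then show ?case by simp
next
  case (Ex n \<phi>)
  have "holds M (v(n := x)) \<phi> \<longleftrightarrow> holds M (w(n := x)) \<phi>" for x
    by (rule Ex.IH) (use Ex.prems in auto)
  then show ?case by simp
qed auto

lemma val_in_dom:
  assumes "is_structure L M" "wf_tm L t" "range v \<subseteq> dom_of M"
  shows "val M v t \<in> dom_of M"
  using assms(2)
proof (induction t)
  case (Fn f ts)
  have "set (map (val M v) ts) \<subseteq> dom_of M" using Fn by auto
  then show ?case using assms(1) Fn.prems by (auto simp: is_structure_def)
qed (use assms(3) in auto)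

abbreviation conjs :: "('f, 'r) fm list \<Rightarrow> ('f, 'r) fm" where
  "conjs \<phi>s \<equiv> foldr Conj \<phi>s Top"

lemma holds_conjs: "holds M v (conjs \<phi>s) \<longleftrightarrow> (\<forall>\<phi>\<in>set \<phi>s. holds M v \<phi>)"
  by (induction \<phi>s) auto

lemma wf_conjs: "wf_fm L (conjs \<phi>s) \<longleftrightarrow> (\<forall>\<phi>\<in>set \<phi>s. wf_fm L \<phi>)"
  by (induction \<phi>s) auto

lemma holds_exs:
  "holds M v (foldr Ex ns \<chi>) \<longleftrightarrow>
    (\<exists>w. (\<forall>k. k \<notin> set ns \<longrightarrow> w k = v k) \<and> (\<forall>k\<in>set ns. w k \<in> dom_of M) \<and> holds M w \<chi>)"
proof (induction ns arbitrary: v)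
  case Nil
  have "(\<forall>k. w k = v k) \<longleftrightarrow> w = v" for w by auto
  then show ?case by simp
next
  case (Cons n ns)
  show ?case
  proof
    assume "holds M v (foldr Ex (n # ns) \<chi>)"
    then obtain x w where "x \<in> dom_of M" "\<forall>k. k \<notin> set ns \<longrightarrow> w k = (v(n := x)) k"
        "\<forall>k\<in>set ns. w k \<in> dom_of M" "holds M w \<chi>"
      by (auto simp: Cons.IH)
    thus "\<exists>w. (\<forall>k. k \<notin> set (n # ns) \<longrightarrow> w k = v k) \<and> (\<forall>k\<in>set (n # ns). w k \<in> dom_of M) \<and> holds M w \<chi>"
      by (intro exI[of _ w]) auto
  next
    assume "\<exists>w. (\<forall>k. k \<notin> set (n # ns) \<longrightarrow> w k = v k) \<and> (\<forall>k\<in>set (n # ns). w k \<in> dom_of M) \<and> holds M w \<chi>"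
    then obtain w where w: "\<forall>k. k \<notin> set (n # ns) \<longrightarrow> w k = v k" "\<forall>k\<in>set (n # ns). w k \<in> dom_of M" "holds M w \<chi>"
      by blast
    hence "holds M (v(n := w n)) (foldr Ex ns \<chi>)" unfolding Cons.IH by (intro exI[of _ w]) auto
    thus "holds M v (foldr Ex (n # ns) \<chi>)" using w(2) by auto
  qed
qed

lemma wf_exs: "wf_fm L (foldr Ex ns \<chi>) \<longleftrightarrow> wf_fm L \<chi>"
  by (induction ns) auto

section \<open>The theorem of Los and homomorphisms into an ultrapower\<close>

section \<open>Ultrapowers\<close>

text \<open>\<open>q\<close> sends a function on the index set to its class modulo \<open>U\<close>, coded in the type \<open>'n\<close>,
  and \<open>d\<close> picks a representative of a class.\<close>

locale ultrapower =
  fixes L :: "('f, 'r) signature" and M :: "('m, 'f, 'r) struct" and U :: "'i filter"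
    and q :: "('i \<Rightarrow> 'm) \<Rightarrow> 'n" and d :: "'n \<Rightarrow> 'i \<Rightarrow> 'm"
  assumes struc: "is_structure L M"
    and proper: "U \<noteq> bot"
    and ultra: "eventually P U \<or> eventually (\<lambda>i. \<not> P i) U"
    and d_in: "(\<And>i. x i \<in> dom_of M) \<Longrightarrow> d (q x) i \<in> dom_of M"
    and d_q: "(\<And>i. x i \<in> dom_of M) \<Longrightarrow> eventually (\<lambda>i. d (q x) i = x i) U"
    and q_eq: "eventually (\<lambda>i. x i = y i) U \<Longrightarrow> q x = q y"
begin

definition N :: "('n, 'f, 'r) struct" where
  "N = \<lparr>dom_of = q ` {x. \<forall>i. x i \<in> dom_of M},
        fint = \<lambda>f zs. q (\<lambda>i. fint M f (map (\<lambda>z. d z i) zs)),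
        rint = \<lambda>R zs. eventually (\<lambda>i. rint M R (map (\<lambda>z. d z i) zs)) U\<rparr>"

lemma N_simps [simp]:
  "dom_of N = q ` {x. \<forall>i. x i \<in> dom_of M}"
  "fint N f zs = q (\<lambda>i. fint M f (map (\<lambda>z. d z i) zs))"
  "rint N R zs = eventually (\<lambda>i. rint M R (map (\<lambda>z. d z i) zs)) U"
  by (simp_all add: N_def)

lemma d_dom: "z \<in> dom_of N \<Longrightarrow> d z i \<in> dom_of M"
  using d_in by auto

lemma q_d: "z \<in> dom_of N \<Longrightarrow> q (d z) = z"
  using d_q q_eq by auto

lemma eq_iff: "z \<in> dom_of N \<Longrightarrow> z' \<in> dom_of N \<Longrightarrow> z = z' \<longleftrightarrow> eventually (\<lambda>i. d z i = d z' i) U"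
  using q_d q_eq[of "d z" "d z'"] by auto

lemma fint_in_dom:
  "f \<in> funs L \<Longrightarrow> set xs \<subseteq> dom_of M \<Longrightarrow> length xs = farity L f \<Longrightarrow> fint M f xs \<in> dom_of M"
  using struc by (auto simp: is_structure_def)

lemma structure_N: "is_structure L N"
proof -
  obtain m where "m \<in> dom_of M" using struc by (auto simp: is_structure_def)
  hence "q (\<lambda>_. m) \<in> dom_of N" by auto
  moreover have "fint N f zs \<in> dom_of N"
    if "f \<in> funs L" "set zs \<subseteq> dom_of N" "length zs = farity L f" for f zs
  proof -
    have "fint M f (map (\<lambda>z. d z i) zs) \<in> dom_of M" for i
      using that d_dom by (intro fint_in_dom) auto
    thus ?thesis by auto
  qed
  ultimately show ?thesis unfolding is_structure_def by blast
qed

lemma eventually_map_eq: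
  assumes "\<And>x. x \<in> set xs \<Longrightarrow> eventually (\<lambda>i. f i x = g i x) U"
  shows "eventually (\<lambda>i. map (f i) xs = map (g i) xs) U"
proof -
  have "eventually (\<lambda>i. \<forall>x\<in>set xs. f i x = g i x) U"
    using assms by (intro eventually_ball_finite) auto
  thus ?thesis by (rule eventually_mono) auto
qed

lemma los_val:
  assumes v: "range v \<subseteq> dom_of N" and "wf_tm L t"
  shows "eventually (\<lambda>i. d (val N v t) i = val M (\<lambda>n. d (v n) i) t) U"
  using assms(2)
proof (induction t)
  case (Fn f ts)
  have "val N v t \<in> dom_of N" if "t \<in> set ts" for t
    using val_in_dom[OF structure_N _ v] that Fn.prems by auto
  hence "fint M f (map (\<lambda>z. d z i) (map (val N v) ts)) \<in> dom_of M" for i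
    using Fn.prems d_dom by (intro fint_in_dom) auto
  hence 1: "eventually (\<lambda>i. d (val N v (Fn f ts)) i = fint M f (map (\<lambda>z. d z i) (map (val N v) ts))) U"
    using d_q[of "\<lambda>i. fint M f (map (\<lambda>z. d z i) (map (val N v) ts))"] by simp
  have "eventually (\<lambda>i. map (\<lambda>t. d (val N v t) i) ts = map (\<lambda>t. val M (\<lambda>n. d (v n) i) t) ts) U"
    using Fn by (intro eventually_map_eq) auto
  with 1 show ?case by eventually_elim (simp add: comp_def)
qed simp

lemma los:
  assumes "range v \<subseteq> dom_of N" "wf_fm L \<phi>"
  shows "holds N v \<phi> \<longleftrightarrow> eventually (\<lambda>i. holds M (\<lambda>n. d (v n) i) \<phi>) U"
  using assms
proof (induction \<phi> arbitrary: v)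
  case Bot
  then show ?case using proper by (simp add: eventually_False)
next
  case (Eq s t)
  have dom: "val N v s \<in> dom_of N" "val N v t \<in> dom_of N"
    using Eq val_in_dom[OF structure_N _ Eq.prems(1)] by auto
  have ev: "eventually (\<lambda>i. d (val N v s) i = val M (\<lambda>n. d (v n) i) s \<and>
      d (val N v t) i = val M (\<lambda>n. d (v n) i) t) U"
    using Eq los_val by (intro eventually_conj) auto
  have "holds N v (Eq s t) \<longleftrightarrow> eventually (\<lambda>i. d (val N v s) i = d (val N v t) i) U"
    using eq_iff[OF dom] by simp
  also have "\<dots> \<longleftrightarrow> eventually (\<lambda>i. holds M (\<lambda>n. d (v n) i) (Eq s t)) U"
    by (rule eventually_cong[OF ev]) auto
  finally show ?case .
next
  case (Rel R ts)
  have "eventually (\<lambda>i. map (\<lambda>t. d (val N v t) i) ts = map (\<lambda>t. val M (\<lambda>n. d (v n) i) t) ts) U"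
    using Rel los_val by (intro eventually_map_eq) auto
  note ev = this
  have "holds N v (Rel R ts) \<longleftrightarrow> eventually (\<lambda>i. rint M R (map (\<lambda>t. d (val N v t) i) ts)) U"
    by (simp add: comp_def)
  also have "\<dots> \<longleftrightarrow> eventually (\<lambda>i. holds M (\<lambda>n. d (v n) i) (Rel R ts)) U"
    by (rule eventually_cong[OF ev]) (simp del: map_eq_conv)
  finally show ?case .
next
  case (Conj \<phi> \<psi>)
  then show ?case by (simp add: eventually_conj_iff)
next
  case (Disj \<phi> \<psi>)
  have "eventually (\<lambda>i. P i \<or> Q i) U \<longleftrightarrow> eventually P U \<or> eventually Q U" for P Q
  proof
    assume PQ: "eventually (\<lambda>i. P i \<or> Q i) U"
    show "eventually P U \<or> eventually Q U"
    proof (cases "eventually P U")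
      case False
      with ultra have "eventually (\<lambda>i. \<not> P i) U" by blast
      with PQ have "eventually Q U" by eventually_elim auto
      then show ?thesis ..
    qed simp
  qed (auto elim: eventually_mono)
  with Disj show ?case by simp
next
  case (Ex n \<phi>)
  have upd: "(\<lambda>k. d ((v(n := z)) k) i) = (\<lambda>k. d (v k) i)(n := d z i)" for z i by auto
  have IH: "holds N (v(n := z)) \<phi> \<longleftrightarrow> eventually (\<lambda>i. holds M ((\<lambda>k. d (v k) i)(n := d z i)) \<phi>) U"
    if "z \<in> dom_of N" for z
    unfolding upd[symmetric] using that Ex.prems by (intro Ex.IH) auto
  show ?case
  proof
    assume "holds N v (Ex n \<phi>)"
    then obtain z where z: "z \<in> dom_of N" "holds N (v(n := z)) \<phi>" by auto
    show "eventually (\<lambda>i. holds M (\<lambda>n. d (v n) i) (Ex n \<phi>)) U"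
      using z(2) unfolding IH[OF z(1)] by (rule eventually_mono) (use d_dom[OF z(1)] in auto)
  next
    assume *: "eventually (\<lambda>i. holds M (\<lambda>n. d (v n) i) (Ex n \<phi>)) U"
    obtain m where m: "m \<in> dom_of M" using struc by (auto simp: is_structure_def)
    \<comment> \<open>A witness at each coordinate that has one; the default \<open>m\<close> keeps
      \<open>x\<close> inside the domain everywhere, so that \<open>q x\<close> is an element of
      \<open>N\<close>.\<close>
    define x where "x = (\<lambda>i. if holds M (\<lambda>n. d (v n) i) (Ex n \<phi>)
      then SOME x. x \<in> dom_of M \<and> holds M ((\<lambda>k. d (v k) i)(n := x)) \<phi> else m)"
    have x: "x i \<in> dom_of M \<and> (holds M (\<lambda>n. d (v n) i) (Ex n \<phi>) \<longrightarrow> holds M ((\<lambda>k. d (v k) i)(n := x i)) \<phi>)" for i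
    proof (cases "holds M (\<lambda>n. d (v n) i) (Ex n \<phi>)")
      case True
      hence "\<exists>x. x \<in> dom_of M \<and> holds M ((\<lambda>k. d (v k) i)(n := x)) \<phi>" by auto
      from someI_ex[OF this] show ?thesis using True by (simp add: x_def del: holds.simps)
    qed (simp add: x_def m del: holds.simps)
    hence qx: "q x \<in> dom_of N" by auto
    have "eventually (\<lambda>i. d (q x) i = x i) U" using x d_q by blast
    with * have "eventually (\<lambda>i. holds M ((\<lambda>k. d (v k) i)(n := d (q x) i)) \<phi>) U"
      by eventually_elim (use x in auto)
    hence "holds N (v(n := q x)) \<phi>" using IH[OF qx] by simp
    thus "holds N v (Ex n \<phi>)" using qx by auto
  qed
qed simp

lemma model_N:
  assumes "is_model L T M" "positive_theory L T"
  shows "is_model L T N"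
  unfolding is_model_def
proof (intro conjI structure_N ballI, clarify)
  fix \<phi> \<psi> v assume T: "(\<phi>, \<psi>) \<in> T" and v: "range v \<subseteq> dom_of N" and "holds N v \<phi>"
  have wf: "wf_fm L \<phi>" "wf_fm L \<psi>" using T assms(2) by (auto simp: positive_theory_def Fm_def)
  have imp: "holds M w \<phi> \<Longrightarrow> holds M w \<psi>" if "range w \<subseteq> dom_of M" for w
    using assms(1) T that by (auto simp: is_model_def)
  have "eventually (\<lambda>i. holds M (\<lambda>n. d (v n) i) \<phi>) U" using \<open>holds N v \<phi>\<close> los[OF v wf(1)] by simp
  hence "eventually (\<lambda>i. holds M (\<lambda>n. d (v n) i) \<psi>) U"
  proof (rule eventually_mono)
    fix i
    have "range (\<lambda>n. d (v n) i) \<subseteq> dom_of M" using v d_dom by blast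
    thus "holds M (\<lambda>n. d (v n) i) \<phi> \<Longrightarrow> holds M (\<lambda>n. d (v n) i) \<psi>" by (rule imp)
  qed
  thus "holds N v \<psi>" using los[OF v wf(2)] by simp
qed

context
  fixes g :: "'i \<Rightarrow> 'm \<Rightarrow> 'm"
  assumes g_dom: "\<And>i m. m \<in> dom_of M \<Longrightarrow> g i m \<in> dom_of M"
begin

definition h :: "'m \<Rightarrow> 'n" where "h m = q (\<lambda>i. g i m)"

lemma d_h: "m \<in> dom_of M \<Longrightarrow> eventually (\<lambda>i. d (h m) i = g i m) U"
  unfolding h_def using g_dom by (intro d_q) auto

lemma h_dom: "m \<in> dom_of M \<Longrightarrow> h m \<in> dom_of N"
  unfolding h_def using g_dom by auto

text \<open>The maps \<open>g i\<close> need not be homomorphisms: each single condition has to hold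
  at almost all \<open>i\<close>, and the exceptional \<open>i\<close> may depend on the condition.
  Maps that respect finite parts of the diagram are therefore enough.\<close>

lemma homomorphism_h:
  assumes fn: "\<And>f xs. f \<in> funs L \<Longrightarrow> set xs \<subseteq> dom_of M \<Longrightarrow> length xs = farity L f \<Longrightarrow>
      eventually (\<lambda>i. g i (fint M f xs) = fint M f (map (g i) xs)) U"
    and rl: "\<And>R xs. R \<in> rels L \<Longrightarrow> set xs \<subseteq> dom_of M \<Longrightarrow> length xs = rarity L R \<Longrightarrow> rint M R xs \<Longrightarrow>
      eventually (\<lambda>i. rint M R (map (g i) xs)) U"
  shows "homomorphism L M N h"
proof -
  have ev: "eventually (\<lambda>i. map (\<lambda>x. d (h x) i) xs = map (g i) xs) U" if "set xs \<subseteq> dom_of M" for xs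
    using that d_h by (intro eventually_map_eq) auto
  have "h (fint M f xs) = fint N f (map h xs)"
    if f: "f \<in> funs L" "set xs \<subseteq> dom_of M" "length xs = farity L f" for f xs
  proof -
    have "eventually (\<lambda>i. g i (fint M f xs) = fint M f (map (\<lambda>z. d z i) (map h xs))) U"
      using fn[OF f] ev[OF f(2)] by eventually_elim (simp add: comp_def del: map_eq_conv)
    thus ?thesis unfolding h_def[of "fint M f xs"] N_simps by (rule q_eq)
  qed
  moreover have "rint N R (map h xs)"
    if R: "R \<in> rels L" "set xs \<subseteq> dom_of M" "length xs = rarity L R" "rint M R xs" for R xs
    using rl[OF R] ev[OF R(2)] unfolding N_simps by eventually_elim (simp add: comp_def del: map_eq_conv)
  ultimately show ?thesis unfolding homomorphism_def using h_dom by blast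
qed

lemma holds_h:
  assumes v: "range v \<subseteq> dom_of M" and \<phi>: "wf_fm L \<phi>" and g: "\<And>i. holds M (g i \<circ> v) \<phi>"
  shows "holds N (h \<circ> v) \<phi>"
proof -
  \<comment> \<open>Each variable has its own exceptional set, and only finitely many variables of
    \<phi> matter.\<close>
  have "eventually (\<lambda>i. \<forall>n\<in>{..<fm_bound \<phi>}. d (h (v n)) i = g i (v n)) U"
    using d_h v by (intro eventually_ball_finite) auto
  hence "eventually (\<lambda>i. holds M (\<lambda>n. d ((h \<circ> v) n) i) \<phi>) U"
  proof (rule eventually_mono)
    fix i assume "\<forall>n\<in>{..<fm_bound \<phi>}. d (h (v n)) i = g i (v n)"
    thus "holds M (\<lambda>n. d ((h \<circ> v) n) i) \<phi>"
      using g[of i] holds_cong[of \<phi> "\<lambda>n. d ((h \<circ> v) n) i" "g i \<circ> v"] by simp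
  qed
  moreover have "range (h \<circ> v) \<subseteq> dom_of N" using h_dom v by (auto simp del: N_simps)
  ultimately show ?thesis using los \<phi> by blast
qed

end

end

section \<open>Maximality of positive types\<close>

section \<open>Types in existentially closed models\<close>

text \<open>The elements mentioned in \<open>D\<close> are named by fresh variables, so that the diagram of \<open>D\<close>
  becomes a formula \<open>\<chi>\<close>, and quantifying these variables away gives a formula true at \<open>v\<close>.\<close>

lemma partial_homomorphism_exists:
  fixes M :: "('m, 'f, 'r) struct" and D :: "(('f + 'r) \<times> 'm list) set"
  assumes struc: "is_structure L M" and v: "range v \<subseteq> dom_of M" and D: "finite D"
    and con: "\<And>\<psi>. wf_fm L \<psi> \<Longrightarrow> holds M v \<psi> \<Longrightarrow>
      \<exists>v'. range v' \<subseteq> dom_of M \<and> holds M v' \<phi> \<and> holds M v' \<psi>"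
  shows "\<exists>g. g ` dom_of M \<subseteq> dom_of M \<and> holds M (g \<circ> v) \<phi> \<and>
    (\<forall>f xs. (Inl f, xs) \<in> D \<and> f \<in> funs L \<and> set xs \<subseteq> dom_of M \<and> length xs = farity L f \<longrightarrow>
      g (fint M f xs) = fint M f (map g xs)) \<and>
    (\<forall>R xs. (Inr R, xs) \<in> D \<and> R \<in> rels L \<and> set xs \<subseteq> dom_of M \<and> length xs = rarity L R \<and> rint M R xs \<longrightarrow>
      rint M R (map g xs))"
proof -
  let ?F = "{(f, xs). (Inl f, xs) \<in> D \<and> f \<in> funs L \<and> set xs \<subseteq> dom_of M \<and> length xs = farity L f}"
  let ?R = "{(R, xs). (Inr R, xs) \<in> D \<and> R \<in> rels L \<and> set xs \<subseteq> dom_of M \<and> length xs = rarity L R \<and> rint M R xs}"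
  have "?F \<subseteq> (\<lambda>(f, xs). (Inl f, xs)) -` D" by auto
  moreover have "finite ((\<lambda>(f, xs). (Inl f, xs)) -` D)"
    by (intro finite_vimageI[OF D]) (auto simp: inj_on_def)
  ultimately have "finite ?F" by (rule finite_subset)
  from finite_list[OF this] obtain Fs where Fs: "set Fs = ?F" ..
  have "?R \<subseteq> (\<lambda>(R, xs). (Inr R, xs)) -` D" by auto
  moreover have "finite ((\<lambda>(R, xs). (Inr R, xs)) -` D)"
    by (intro finite_vimageI[OF D]) (auto simp: inj_on_def)
  ultimately have "finite ?R" by (rule finite_subset)
  from finite_list[OF this] obtain Rs where Rs: "set Rs = ?R" ..
  define ss where "ss = concat (map (\<lambda>(f, xs). fint M f xs # xs) Fs) @ concat (map snd Rs)"
  have ss: "set ss \<subseteq> dom_of M"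
    using struc by (auto simp: ss_def Fs Rs is_structure_def)
  let ?n = "fm_bound \<phi>" and ?K = "fm_bound \<phi> + length ss"
  \<comment> \<open>Variables below \<open>?n\<close> keep the values of \<open>v\<close>, so that
    \<phi> and the quantified \<chi> speak about the same tuple; the slots from \<open>?n\<close> to
    \<open>?K\<close> hold the elements of \<open>ss\<close>.\<close>
  define u where "u = (\<lambda>k. if ?n \<le> k \<and> k < ?K then ss ! (k - ?n) else v k)"
  have "\<exists>k<?K. u k = x" if x: "x \<in> set ss" for x
  proof -
    obtain j where "j < length ss" "ss ! j = x" using x by (auto simp: in_set_conv_nth)
    thus ?thesis by (intro exI[of _ "?n + j"]) (simp add: u_def)
  qed
  then obtain ix where ix: "\<And>x. x \<in> set ss \<Longrightarrow> ix x < ?K \<and> u (ix x) = x" by metis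
  \<comment> \<open>The last group of conjuncts records all equations between these variables. It
    makes \<open>g\<close> well defined below and ties an element of \<open>ss\<close> that is also
    a value of \<open>v\<close> to the free variable for it.\<close>
  define \<chi> :: "('f, 'r) fm" where "\<chi> = conjs (
    map (\<lambda>(f, xs). Eq (Var (ix (fint M f xs))) (Fn f (map (\<lambda>x. Var (ix x)) xs))) Fs @
    map (\<lambda>(R, xs). Rel R (map (\<lambda>x. Var (ix x)) xs)) Rs @
    map (\<lambda>(i, j). Eq (Var i) (Var j)) (filter (\<lambda>(i, j). u i = u j) (List.product [0..<?K] [0..<?K])))"
  have ssF: "fint M f xs \<in> set ss" "set xs \<subseteq> set ss" if "(f, xs) \<in> set Fs" for f xs
    using that by (force simp: ss_def)+
  have ssR: "set xs \<subseteq> set ss" if "(R, xs) \<in> set Rs" for R xs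
    using that by (force simp: ss_def)
  have uix: "map (\<lambda>x. u (ix x)) xs = xs" if "set xs \<subseteq> set ss" for xs
    using ix that by (intro map_idI) auto
  have "wf_fm L \<chi>" unfolding \<chi>_def wf_conjs using Fs Rs by auto
  moreover have "holds M u \<chi>" unfolding \<chi>_def holds_conjs
    using ssF ssR ix Rs by (auto simp: comp_def uix)
  ultimately have \<psi>: "wf_fm L (foldr Ex [?n..<?K] \<chi>)" "holds M v (foldr Ex [?n..<?K] \<chi>)"
    unfolding wf_exs holds_exs
    using ss v by (auto intro!: exI[of _ u] simp: u_def subset_iff)
  obtain v' where v': "range v' \<subseteq> dom_of M" "holds M v' \<phi>" "holds M v' (foldr Ex [?n..<?K] \<chi>)"
    using con[OF \<psi>] by blast
  from v'(3) obtain w where w: "\<And>k. k \<notin> {?n..<?K} \<Longrightarrow> w k = v' k" "\<And>k. k \<in> {?n..<?K} \<Longrightarrow> w k \<in> dom_of M"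
      "holds M w \<chi>"
    unfolding holds_exs set_upt by blast
  have w_dom: "w k \<in> dom_of M" for k using w(1,2)[of k] v'(1) by (cases "k \<in> {?n..<?K}") auto
  have wF: "w (ix (fint M f xs)) = fint M f (map (\<lambda>x. w (ix x)) xs)" if "(f, xs) \<in> set Fs" for f xs
    using w(3) that unfolding \<chi>_def holds_conjs by (force simp: comp_def)
  have wR: "rint M R (map (\<lambda>x. w (ix x)) xs)" if "(R, xs) \<in> set Rs" for R xs
    using w(3) that unfolding \<chi>_def holds_conjs by (force simp: comp_def)
  have wE: "w i = w j" if "i < ?K" "j < ?K" "u i = u j" for i j
    using w(3) that unfolding \<chi>_def holds_conjs by (force simp: comp_def)
  \<comment> \<open>Several variables may name \<open>x\<close>; by \<open>wE\<close> they have
    equal values under \<open>w\<close>. Elements without a name are left fixed, which keeps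
    \<open>g\<close> inside the domain.\<close>
  define g where "g = (\<lambda>x. if \<exists>k<?K. u k = x then w (SOME k. k < ?K \<and> u k = x) else x)"
  have g: "g (u k) = w k" if "k < ?K" for k
  proof -
    have ex: "\<exists>j. j < ?K \<and> u j = u k" using that by blast
    have "(SOME j. j < ?K \<and> u j = u k) < ?K \<and> u (SOME j. j < ?K \<and> u j = u k) = u k"
      by (rule someI_ex[OF ex])
    thus ?thesis using wE[of "SOME j. j < ?K \<and> u j = u k" k] that ex by (simp add: g_def)
  qed
  have gix: "g x = w (ix x)" if "x \<in> set ss" for x using g ix[OF that] by metis
  have gixs: "map g xs = map (\<lambda>x. w (ix x)) xs" if "set xs \<subseteq> set ss" for xs using gix that by (intro map_cong) auto
  have "holds M (g \<circ> v) \<phi> \<longleftrightarrow> holds M v' \<phi>"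
  proof (rule holds_cong)
    fix i assume i: "i < ?n"
    hence "g (v i) = w i" using g[of i] by (simp add: u_def)
    thus "(g \<circ> v) i = v' i" using w(1) i by simp
  qed
  moreover have "g ` dom_of M \<subseteq> dom_of M" using w_dom by (auto simp: g_def)
  moreover have "g (fint M f xs) = fint M f (map g xs)" if "(f, xs) \<in> set Fs" for f xs
    using wF[OF that] gix gixs ssF[OF that] by (simp del: map_eq_conv)
  moreover have "rint M R (map g xs)" if "(R, xs) \<in> set Rs" for R xs
    using wR[OF that] gixs ssR[OF that] by (simp del: map_eq_conv)
  ultimately show ?thesis using v'(2) unfolding Fs Rs by blast
qed

text \<open>The domain is the type of functions that make up the ultrapower below, the range is the
  type of the test models in \<open>existentially_closed\<close>. A function is coded by its graph.
  The graph fits because symbols inject into formulas and the type of formulas is infinite, so that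
  lists and products do not increase the cardinal.\<close>

lemma inj_fun_into_set:
  "\<exists>c :: ((('f + 'r) \<times> 'm list) list \<Rightarrow> 'm) \<Rightarrow> ('m + ('f, 'r) fm) set. inj c"
proof -
  let ?K = "|UNIV :: ('m + ('f, 'r) fm) set|"
  have "inj (\<lambda>n. Inr (Ex n Top) :: 'm + ('f, 'r) fm)" by (auto simp: inj_on_def)
  hence "infinite (UNIV :: ('m + ('f, 'r) fm) set)"
    by (metis finite_subset infinite_UNIV_nat finite_imageD subset_UNIV)
  hence K: "Cinfinite ?K" by (simp add: cinfinite_def Field_card_of card_of_card_order_on)
  have inf: "\<not> finite (Field ?K)" "Card_order ?K" using K by (auto simp: cinfinite_def)
  have "inj (case_sum (\<lambda>f. Inr (Eq (Fn f []) (Var 0))) (\<lambda>R. Inr (Rel R [])) :: 'f + 'r \<Rightarrow> 'm + ('f, 'r) fm)"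
    by (auto simp: inj_on_def split: sum.splits)
  hence "|UNIV :: ('f + 'r) set| \<le>o ?K" by (rule card_of_ordLeqI) simp
  moreover have m: "|UNIV :: 'm set| \<le>o ?K" by (rule card_of_ordLeqI[of Inl]) auto
  hence "|lists (UNIV :: 'm set)| \<le>o ?K" by (rule Card_order_lists_le[OF K])
  ultimately have "|(UNIV :: ('f + 'r) set) \<times> lists (UNIV :: 'm set)| \<le>o ?K"
    using inf by (intro card_of_Times_ordLeq_infinite_Field)
  hence "|lists ((UNIV :: ('f + 'r) set) \<times> lists (UNIV :: 'm set))| \<le>o ?K"
    by (rule Card_order_lists_le[OF K])
  hence "|lists ((UNIV :: ('f + 'r) set) \<times> lists (UNIV :: 'm set)) \<times> (UNIV :: 'm set)| \<le>o ?K"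
    using inf m by (intro card_of_Times_ordLeq_infinite_Field)
  then obtain e :: "(('f + 'r) \<times> 'm list) list \<times> 'm \<Rightarrow> 'm + ('f, 'r) fm" where e: "inj e"
    unfolding card_of_ordLeq[symmetric] by auto
  have "inj (\<lambda>x. e ` range (\<lambda>i. (i, x i)))"
  proof (rule injI)
    fix x y :: "(('f + 'r) \<times> 'm list) list \<Rightarrow> 'm"
    assume "e ` range (\<lambda>i. (i, x i)) = e ` range (\<lambda>i. (i, y i))"
    hence eq: "range (\<lambda>i. (i, x i)) = range (\<lambda>i. (i, y i))" using e by (simp add: inj_image_eq_iff)
    have "x i = y i" for i
    proof -
      have "(i, x i) \<in> range (\<lambda>i. (i, y i))" unfolding eq[symmetric] by simp
      thus ?thesis by auto
    qed
    thus "x = y" by auto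
  qed
  thus ?thesis by blast
qed

text \<open>Suppose \<phi> is compatible in \<open>M\<close> with every positive formula true at
  \<open>v\<close>. Then each finite part of the positive diagram of \<open>M\<close> is respected
  by some map of \<open>M\<close> into itself that sends \<open>v\<close> to a solution of \<phi>.
  These maps combine to a homomorphism into an ultrapower, under which the image of \<open>v\<close>
  satisfies \<phi>. It is an immersion, so \<phi> holds at \<open>v\<close>.\<close>

lemma existentially_closed_refutation:
  fixes M :: "('m, 'f, 'r) struct"
  assumes T: "positive_theory L T" and ec: "existentially_closed L T M"
    and v: "range v \<subseteq> dom_of M" and \<phi>: "\<phi> \<in> Fm L" and not: "\<not> holds M v \<phi>"
  shows "\<exists>\<psi>\<in>Fm L. holds M v \<psi> \<and>
    (\<forall>v'. range v' \<subseteq> dom_of M \<longrightarrow> holds M v' \<psi> \<longrightarrow> \<not> holds M v' \<phi>)"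
proof (rule ccontr)
  assume "\<not> ?thesis"
  hence con: "\<And>\<psi>. wf_fm L \<psi> \<Longrightarrow> holds M v \<psi> \<Longrightarrow> \<exists>v'. range v' \<subseteq> dom_of M \<and> holds M v' \<phi> \<and> holds M v' \<psi>"
    unfolding Fm_def by blast
  have M: "is_model L T M" "is_structure L M"
    using ec by (auto simp: existentially_closed_def is_model_def)
  define P where "P = (\<lambda>(D :: (('f + 'r) \<times> 'm list) list) g. g ` dom_of M \<subseteq> dom_of M \<and> holds M (g \<circ> v) \<phi> \<and>
    (\<forall>f xs. (Inl f, xs) \<in> set D \<and> f \<in> funs L \<and> set xs \<subseteq> dom_of M \<and> length xs = farity L f \<longrightarrow>
      g (fint M f xs) = fint M f (map g xs)) \<and>
    (\<forall>R xs. (Inr R, xs) \<in> set D \<and> R \<in> rels L \<and> set xs \<subseteq> dom_of M \<and> length xs = rarity L R \<and> rint M R xs \<longrightarrow>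
      rint M R (map g xs)))"
  have "\<exists>g. P D g" for D unfolding P_def by (rule partial_homomorphism_exists[OF M(2) v _ con]) auto
  then obtain g where g: "\<And>D. P D (g D)" by metis
  \<comment> \<open>Generated by the sets of lists that contain a given condition. An ultrafilter
    below it makes every condition hold almost everywhere.\<close>
  define F0 :: "(('f + 'r) \<times> 'm list) list filter" where "F0 = filtercomap set (finite_subsets_at_top UNIV)"
  have "F0 \<noteq> bot" unfolding F0_def
  proof (rule filtercomap_neq_bot)
    fix Q assume "eventually Q (finite_subsets_at_top (UNIV :: (('f + 'r) \<times> 'm list) set))"
    then obtain X where "finite X" "Q X" by (auto simp: eventually_finite_subsets_at_top)
    thus "\<exists>D. Q (set D)" using finite_list by blast
  qed
  then obtain U where U: "U \<le> F0" "U \<noteq> bot" "\<And>P. eventually P U \<or> eventually (\<lambda>x. \<not> P x) U"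
    using ultrafilter_exists by blast
  have mem: "eventually (\<lambda>D. p \<in> set D) U" for p
  proof (rule filter_leD[OF U(1)])
    show "eventually (\<lambda>D. p \<in> set D) F0" unfolding F0_def eventually_filtercomap
      by (rule exI[of _ "\<lambda>X. p \<in> X"])
        (auto simp: eventually_finite_subsets_at_top intro!: exI[of _ "{p}"])
  qed
  obtain c :: "((('f + 'r) \<times> 'm list) list \<Rightarrow> 'm) \<Rightarrow> ('m + ('f, 'r) fm) set" where c: "inj c"
    using inj_fun_into_set by blast
  \<comment> \<open>The choice depends on the class of \<open>x\<close> alone, since equivalent
    functions give equivalent predicates. Asking for values in the domain at every index, and not
    only almost everywhere, is what \<open>d_in\<close> requires.\<close>
  define rep where "rep = (\<lambda>x. SOME y. (\<forall>i. y i \<in> dom_of M) \<and> eventually (\<lambda>i. y i = x i) U)"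
  have rep: "(\<forall>i. rep x i \<in> dom_of M) \<and> eventually (\<lambda>i. rep x i = x i) U" if "\<And>i. x i \<in> dom_of M" for x
    unfolding rep_def by (rule someI[of _ x]) (use that in auto)
  have rep_eq: "rep x = rep y" if xy: "eventually (\<lambda>i. x i = y i) U" for x y
  proof -
    have "eventually (\<lambda>i. z i = x i) U \<longleftrightarrow> eventually (\<lambda>i. z i = y i) U" for z
      by (rule eventually_cong[OF xy]) auto
    thus ?thesis by (simp add: rep_def)
  qed
  interpret ultrapower L M U "\<lambda>x. c (rep x)" "inv c"
    by unfold_locales (use M(2) U rep rep_eq c in auto)
  have g_dom: "g D m \<in> dom_of M" if "m \<in> dom_of M" for D m using g[of D] that by (auto simp: P_def)
  have "homomorphism L M N (h g)"
  proof (rule homomorphism_h)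
    fix f xs assume f: "f \<in> funs L" "set xs \<subseteq> dom_of M" "length xs = farity L f"
    show "eventually (\<lambda>D. g D (fint M f xs) = fint M f (map (g D) xs)) U"
      using mem[of "(Inl f, xs)"] by (rule eventually_mono) (use f g in \<open>auto simp: P_def\<close>)
  next
    fix R xs assume R: "R \<in> rels L" "set xs \<subseteq> dom_of M" "length xs = rarity L R" "rint M R xs"
    show "eventually (\<lambda>D. rint M R (map (g D) xs)) U"
      using mem[of "(Inr R, xs)"] by (rule eventually_mono) (use R g in \<open>auto simp: P_def\<close>)
  qed (rule g_dom)
  hence "immersion L M N (h g)"
    using ec model_N[OF M(1) T] unfolding existentially_closed_def by blast
  moreover have "holds N (h g \<circ> v) \<phi>"
    by (rule holds_h) (use g_dom g v \<phi> in \<open>auto simp: P_def Fm_def\<close>)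
  ultimately show False using \<phi> v not unfolding immersion_def by blast
qed

text \<open>A formula of the larger type that fails at \<open>x\<close> is excluded by some \<psi>
  true at \<open>x\<close>. Under the same substitution \<open>s\<close>, hence with the same
  parameters and variables, \<psi> passes to \<open>y\<close> and contradicts that formula
  there.\<close>

lemma positive_type_maximal:
  assumes T: "positive_theory L T" and ec: "existentially_closed L T M"
    and C: "C \<subseteq> dom_of M" and x: "x ` J \<subseteq> dom_of M" and y: "y ` J \<subseteq> dom_of M"
    and sub: "positive_type L M C J x \<subseteq> positive_type L M C J y"
  shows "positive_type L M C J x = positive_type L M C J y"
proof (rule ccontr)
  assume "\<not> ?thesis"
  then obtain \<phi> s where p: "(\<phi>, s) \<in> Pfm L J C" "satisfies M y (\<phi>, s)" "\<not> satisfies M x (\<phi>, s)"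
    using sub by (auto simp: positive_type_def)
  have \<phi>: "\<phi> \<in> Fm L" and s: "range s \<subseteq> J <+> C" using p(1) by (auto simp: Pfm_def)
  have ran: "range (case_sum z id \<circ> s) \<subseteq> dom_of M" if "z ` J \<subseteq> dom_of M" for z
  proof -
    have "case_sum z id (s n) \<in> dom_of M" for n
    proof -
      have "s n \<in> J <+> C" using s by blast
      thus ?thesis using C that by (auto elim!: PlusE)
    qed
    thus ?thesis by auto
  qed
  obtain \<psi> where \<psi>: "\<psi> \<in> Fm L" "holds M (case_sum x id \<circ> s) \<psi>"
    "\<And>v'. range v' \<subseteq> dom_of M \<Longrightarrow> holds M v' \<psi> \<Longrightarrow> \<not> holds M v' \<phi>"
    using existentially_closed_refutation[OF T ec ran[OF x] \<phi>] p(3) by (auto simp: satisfies_def)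
  have "(\<psi>, s) \<in> positive_type L M C J x"
    using \<psi>(1,2) s by (simp add: positive_type_def Pfm_def satisfies_def)
  hence "holds M (case_sum y id \<circ> s) \<psi>" using sub by (auto simp: positive_type_def satisfies_def)
  thus False using \<psi>(3)[OF ran[OF y]] p(2) by (simp add: satisfies_def)
qed

section \<open>Quantifier-free types\<close>

lemma qf_true_cong: "(\<And>A. A \<in> set_qf \<phi> \<Longrightarrow> V A \<longleftrightarrow> W A) \<Longrightarrow> qf_true V \<phi> \<longleftrightarrow> qf_true W \<phi>"
  by (induction \<phi>) auto

lemma str_qf_equivI:
  assumes "length \<eta>s = length \<nu>s"
    and "\<And>A. str_vars A \<subseteq> {..<length \<nu>s} \<Longrightarrow> str_true r \<eta>s A \<longleftrightarrow> str_true r' \<nu>s A"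
  shows "str_qf_equiv r \<eta>s r' \<nu>s"
proof -
  have "qf_true (str_true r \<eta>s) \<phi> \<longleftrightarrow> qf_true (str_true r' \<nu>s) \<phi>"
    if "\<forall>A\<in>set_qf \<phi>. str_vars A \<subseteq> {..<length \<nu>s}" for \<phi>
    by (rule qf_true_cong) (use that assms(2) in auto)
  thus ?thesis using assms(1) by (auto simp: str_qf_equiv_def str_qf_type_def)
qed

lemma str_qf_equivD:
  assumes "str_qf_equiv r \<eta>s r' \<nu>s" "str_vars A \<subseteq> {..<length \<eta>s}"
  shows "str_true r \<eta>s A \<longleftrightarrow> str_true r' \<nu>s A"
proof -
  have "QAtom A \<in> str_qf_type r \<eta>s \<longleftrightarrow> QAtom A \<in> str_qf_type r' \<nu>s" "length \<eta>s = length \<nu>s"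
    using assms(1) by (auto simp: str_qf_equiv_def)
  thus ?thesis using assms(2) by (simp add: str_qf_type_def)
qed

lemma s_qf_equivI:
  assumes "length \<eta>s = length \<nu>s"
    and "\<And>A. s_vars A \<subseteq> {..<length \<nu>s} \<Longrightarrow> s_true r \<eta>s A \<longleftrightarrow> s_true r \<nu>s A"
  shows "s_qf_equiv r \<eta>s \<nu>s"
proof -
  have "qf_true (s_true r \<eta>s) \<phi> \<longleftrightarrow> qf_true (s_true r \<nu>s) \<phi>"
    if "\<forall>A\<in>set_qf \<phi>. s_vars A \<subseteq> {..<length \<nu>s}" for \<phi>
    by (rule qf_true_cong) (use that assms(2) in auto)
  thus ?thesis using assms(1) by (auto simp: s_qf_equiv_def s_qf_type_def)
qed

section \<open>Spreading finite sequences along levels; from str-types to s-types\<close>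

section \<open>Embedding the tree of finite sequences\<close>

lemma underS_inj:
  assumes "Well_order r" "a \<in> Field r" "b \<in> Field r" "underS r a = underS r b"
  shows "a = b"
proof (rule ccontr)
  assume "a \<noteq> b"
  hence "a \<in> underS r b \<or> b \<in> underS r a"
    using wo_rel.TOTALS[unfolded wo_rel_def, OF assms(1)] assms(2,3) by (auto simp: underS_def)
  thus False using assms(4) by (auto simp: underS_def)
qed

lemma node_len_eqI:
  assumes "Well_order r" "\<gamma> \<in> Field r" "dom \<eta> = underS r \<gamma>"
  shows "node_len r \<eta> = \<gamma>"
  unfolding node_len_def using assms by (intro the_equality) (auto intro: underS_inj)

abbreviation len :: "nat node \<Rightarrow> nat" where
  "len \<equiv> node_len natLeq"

lemma underS_natLeq: "underS natLeq n = {..<n}"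
  by (auto simp: natLeq_underS_less)

lemma under_natLeq: "under natLeq n = {..n}"
  by (auto simp: under_def natLeq_def)

lemma tree_natLeqI:
  assumes "dom \<eta> = {..<n}"
  shows "\<eta> \<in> tree natLeq" "len \<eta> = n"
  using assms node_len_eqI[OF natLeq_Well_order, of n \<eta>]
  by (auto simp: tree_def Field_natLeq underS_natLeq)

lemma dom_natLeq: "\<eta> \<in> tree natLeq \<Longrightarrow> dom \<eta> = {..<len \<eta>}"
  using tree_natLeqI(2)[of \<eta>] by (auto simp: tree_def underS_natLeq)

lemma node_meet_natLeq:
  assumes "\<eta> \<in> tree natLeq" "\<nu> \<in> tree natLeq"
  obtains k where "dom (node_meet natLeq \<eta> \<nu>) = {..<k}" "k \<le> len \<eta>" "k \<le> len \<nu>"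
    "\<And>j. j < k \<Longrightarrow> \<eta> j = \<nu> j" "\<And>j. j < k \<Longrightarrow> node_meet natLeq \<eta> \<nu> j = \<eta> j"
    "k < len \<eta> \<Longrightarrow> k < len \<nu> \<Longrightarrow> \<eta> k \<noteq> \<nu> k"
proof -
  let ?S = "{i \<in> dom \<eta> \<inter> dom \<nu>. \<forall>j\<in>{..i}. \<eta> j = \<nu> j}"
  define k where "k = (LEAST i. i \<notin> ?S)"
  have "len \<eta> \<notin> ?S" using dom_natLeq[OF assms(1)] by auto
  hence k: "k \<notin> ?S" unfolding k_def by (rule LeastI)
  have less: "j \<in> ?S" if "j < k" for j using that not_less_Least unfolding k_def by blast
  have dm: "dom (node_meet natLeq \<eta> \<nu>) = ?S"
    by (auto simp: node_meet_def restrict_map_def under_natLeq split: if_splits)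
  have S: "?S = {..<k}"
  proof
    show "{..<k} \<subseteq> ?S" using less by blast
    show "?S \<subseteq> {..<k}"
    proof
      fix i assume i: "i \<in> ?S"
      show "i \<in> {..<k}"
      proof (rule ccontr)
        assume "i \<notin> {..<k}"
        hence "k \<le> i" by simp
        hence "k \<in> ?S" using i dom_natLeq assms by auto
        thus False using k by blast
      qed
    qed
  qed
  have doms: "j < len \<eta> \<and> j < len \<nu>" if "j < k" for j using less[OF that] dom_natLeq assms by auto
  have "k \<le> len \<eta> \<and> k \<le> len \<nu>" using doms by (metis leI less_irrefl)
  moreover have "\<eta> k \<noteq> \<nu> k" if "k < len \<eta>" "k < len \<nu>"
  proof
    assume "\<eta> k = \<nu> k"
    hence "\<forall>j\<in>{..k}. \<eta> j = \<nu> j" using less by (auto simp: le_less)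
    thus False using k that dom_natLeq assms by auto
  qed
  moreover have "node_meet natLeq \<eta> \<nu> j = \<eta> j" if "j < k" for j
    using less[OF that] by (simp add: node_meet_def restrict_map_def under_natLeq)
  ultimately show ?thesis using that[of k] dm S less by auto
qed

definition increasing :: "'i rel \<Rightarrow> (nat \<Rightarrow> 'i) \<Rightarrow> bool" where
  "increasing r h \<longleftrightarrow> (\<forall>m n. m < n \<longrightarrow> h m \<in> underS r (h n))"

text \<open>The level \<open>n\<close> is sent to the level \<open>h n\<close>; a sequence is spread along \<open>h\<close> and filled up with
  zeros.\<close>

definition emb :: "'i rel \<Rightarrow> (nat \<Rightarrow> 'i) \<Rightarrow> nat node \<Rightarrow> 'i node" where
  "emb r h \<eta> = (\<lambda>\<delta>. if \<delta> \<in> underS r (h (len \<eta>))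
     then Some (if \<exists>j<len \<eta>. h j = \<delta> then the (\<eta> (SOME j. j < len \<eta> \<and> h j = \<delta>)) else 0) else None)"

text \<open>The level \<open>h (len \<eta>)\<close> counts too, being the length of the image. So a
  node of length less than \<open>K\<close> is controlled by the first \<open>K\<close>
  levels.\<close>

lemma emb_cong:
  assumes "\<And>j. j \<le> len \<eta> \<Longrightarrow> h j = h' j"
  shows "emb r h \<eta> = emb r h' \<eta>"
proof -
  have "(j < len \<eta> \<and> h j = \<delta>) \<longleftrightarrow> (j < len \<eta> \<and> h' j = \<delta>)" for j \<delta> using assms[of j] by auto
  thus ?thesis unfolding emb_def assms[OF order_refl] by (simp only:)
qed

lemma increasing_comp: "increasing r h \<Longrightarrow> strict_mono f \<Longrightarrow> increasing r (h \<circ> f)"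
  by (simp add: increasing_def strict_mono_def)

locale level_embedding =
  fixes r :: "'i rel" and h :: "nat \<Rightarrow> 'i"
  assumes wo: "Well_order r" and inc: "increasing r h"
begin

lemma h_Field: "h n \<in> Field r"
  using inc[unfolded increasing_def, rule_format, of n "Suc n"] by (auto simp: underS_def Field_def)

lemma h_less: "m < n \<Longrightarrow> h m \<in> underS r (h n)"
  using inc by (simp add: increasing_def)

lemma antisym: "(x, y) \<in> r \<Longrightarrow> (y, x) \<in> r \<Longrightarrow> x = y"
  using wo_rel.ANTISYM[unfolded wo_rel_def, OF wo] by (rule antisymD)

lemma trans: "(x, y) \<in> r \<Longrightarrow> (y, z) \<in> r \<Longrightarrow> (x, z) \<in> r"
  using wo_rel.TRANS[unfolded wo_rel_def, OF wo] by (rule transD)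

lemma h_less_iff: "h m \<in> underS r (h n) \<longleftrightarrow> m < n"
proof
  assume *: "h m \<in> underS r (h n)"
  show "m < n"
  proof (rule ccontr)
    assume "\<not> m < n"
    hence "n < m \<or> n = m" by auto
    thus False using * h_less[of n m] antisym by (auto simp: underS_def)
  qed
qed (rule h_less)

lemma h_eq_iff: "h m = h n \<longleftrightarrow> m = n"
  using h_less_iff by (metis nat_neq_iff)

lemma underS_mono: "m \<le> n \<Longrightarrow> underS r (h m) \<subseteq> underS r (h n)"
proof
  fix \<delta> assume "m \<le> n" "\<delta> \<in> underS r (h m)"
  moreover have "(h m, h n) \<in> r" if "m < n" using h_less[OF that] by (simp add: underS_def)
  ultimately show "\<delta> \<in> underS r (h n)"
    by (cases "m = n") (auto simp: underS_def dest: trans antisym)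
qed

lemma underS_down: "\<delta> \<in> underS r x \<Longrightarrow> (\<epsilon>, \<delta>) \<in> r \<Longrightarrow> \<epsilon> \<in> underS r x"
  by (auto simp: underS_def dest: trans antisym)

lemma dom_emb: "dom (emb r h \<eta>) = underS r (h (len \<eta>))"
  by (auto simp: emb_def dom_def)

lemma emb_tree: "emb r h \<eta> \<in> tree r"
  using dom_emb h_Field by (auto simp: tree_def)

lemma node_len_emb: "node_len r (emb r h \<eta>) = h (len \<eta>)"
  by (rule node_len_eqI[OF wo h_Field dom_emb])

lemma emb_h:
  assumes "\<eta> \<in> tree natLeq"
  shows "emb r h \<eta> (h j) = \<eta> j"
proof (cases "j < len \<eta>")
  case True
  have "(SOME i. i < len \<eta> \<and> h i = h j) = j" using True by (intro some_equality) (auto simp: h_eq_iff)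
  moreover have "\<exists>y. \<eta> j = Some y" using dom_natLeq[OF assms] True by auto
  ultimately show ?thesis using True h_less by (auto simp: emb_def)
next
  case False
  hence "j \<notin> dom \<eta>" using dom_natLeq[OF assms] by auto
  then show ?thesis using False by (auto simp: emb_def h_less_iff dom_def)
qed

lemma emb_other: "\<delta> \<notin> range h \<Longrightarrow> \<delta> \<in> underS r (h (len \<eta>)) \<Longrightarrow> emb r h \<eta> \<delta> = Some 0"
  by (auto simp: emb_def)

text \<open>Between chosen levels all nodes carry the same filling value, so images can branch at
  chosen levels only. The lemmas on extension, lexicographic order and meets rest on this.\<close>

lemma emb_agree:
  assumes "\<eta> \<in> tree natLeq" "\<nu> \<in> tree natLeq" "k \<le> len \<eta>" "k \<le> len \<nu>"
    and "\<And>j. j < k \<Longrightarrow> \<eta> j = \<nu> j" and "\<delta> \<in> underS r (h k)"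
  shows "emb r h \<eta> \<delta> = emb r h \<nu> \<delta>"
proof (cases "\<delta> \<in> range h")
  case True
  then show ?thesis using assms emb_h h_less_iff by auto
next
  case False
  then show ?thesis using assms(3,4,6) underS_mono emb_other by (metis subsetD)
qed

lemma emb_ext_iff:
  assumes "\<eta> \<in> tree natLeq" "\<nu> \<in> tree natLeq"
  shows "node_ext (emb r h \<eta>) (emb r h \<nu>) \<longleftrightarrow> node_ext \<eta> \<nu>"
proof
  assume "node_ext (emb r h \<eta>) (emb r h \<nu>)"
  hence "j \<in> dom \<eta> \<Longrightarrow> \<eta> j = \<nu> j" for j
    using emb_h assms by (metis domIff map_le_def)
  thus "node_ext \<eta> \<nu>" by (simp add: map_le_def)
next
  assume ext: "node_ext \<eta> \<nu>"
  hence "dom \<eta> \<subseteq> dom \<nu>" by (rule map_le_implies_dom_le)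
  hence "len \<eta> \<le> len \<nu>" using dom_natLeq assms by auto
  moreover have "\<eta> j = \<nu> j" if "j < len \<eta>" for j
    using ext that dom_natLeq[OF assms(1)] by (auto simp: map_le_def)
  ultimately have "emb r h \<eta> \<delta> = emb r h \<nu> \<delta>" if "\<delta> \<in> underS r (h (len \<eta>))" for \<delta>
    using emb_agree[OF assms] that by blast
  thus "node_ext (emb r h \<eta>) (emb r h \<nu>)" by (simp add: map_le_def dom_emb)
qed

lemma emb_eq_iff:
  assumes "\<eta> \<in> tree natLeq" "\<nu> \<in> tree natLeq"
  shows "emb r h \<eta> = emb r h \<nu> \<longleftrightarrow> \<eta> = \<nu>"
  using emb_ext_iff[OF assms] emb_ext_iff[OF assms(2,1)] by (metis map_le_antisym map_le_refl)

lemma emb_lex_iff: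
  assumes "\<eta> \<in> tree natLeq" "\<nu> \<in> tree natLeq"
  shows "node_lex r (emb r h \<eta>) (emb r h \<nu>) \<longleftrightarrow> node_lex natLeq \<eta> \<nu>"
proof -
  have "(\<exists>\<gamma>\<in>dom (emb r h \<eta>) \<inter> dom (emb r h \<nu>). (\<forall>j\<in>underS r \<gamma>. emb r h \<eta> j = emb r h \<nu> j) \<and>
      the (emb r h \<eta> \<gamma>) < the (emb r h \<nu> \<gamma>)) \<longleftrightarrow>
    (\<exists>k\<in>dom \<eta> \<inter> dom \<nu>. (\<forall>j\<in>underS natLeq k. \<eta> j = \<nu> j) \<and> the (\<eta> k) < the (\<nu> k))"
    (is "?L \<longleftrightarrow> ?R")
  proof
    assume ?L
    then obtain \<gamma> where \<gamma>: "\<gamma> \<in> dom (emb r h \<eta>)" "\<gamma> \<in> dom (emb r h \<nu>)"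
      "\<And>j. j \<in> underS r \<gamma> \<Longrightarrow> emb r h \<eta> j = emb r h \<nu> j" "the (emb r h \<eta> \<gamma>) < the (emb r h \<nu> \<gamma>)" by blast
    have "\<gamma> \<in> range h"
    proof (rule ccontr)
      assume "\<gamma> \<notin> range h"
      hence "emb r h \<eta> \<gamma> = emb r h \<nu> \<gamma>" using \<gamma>(1,2) emb_other by (simp add: dom_emb)
      thus False using \<gamma>(4) by simp
    qed
    then obtain k where k: "\<gamma> = h k" by auto
    have "\<eta> j = \<nu> j" if "j < k" for j using \<gamma>(3)[of "h j"] h_less[OF that] assms by (simp add: k emb_h)
    moreover have "k \<in> dom \<eta> \<inter> dom \<nu>" using \<gamma>(1,2) assms by (simp add: k emb_h dom_def)
    moreover have "the (\<eta> k) < the (\<nu> k)" using \<gamma>(4) assms by (simp add: k emb_h)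
    ultimately show ?R by (auto simp: underS_natLeq)
  next
    assume ?R
    then obtain k where k: "k \<in> dom \<eta>" "k \<in> dom \<nu>" "\<And>j. j < k \<Longrightarrow> \<eta> j = \<nu> j" "the (\<eta> k) < the (\<nu> k)"
      by (auto simp: underS_natLeq)
    have "k \<le> len \<eta>" "k \<le> len \<nu>" using k(1,2) dom_natLeq assms by auto
    hence "\<forall>j\<in>underS r (h k). emb r h \<eta> j = emb r h \<nu> j" using emb_agree[OF assms] k(3) by blast
    moreover have "h k \<in> dom (emb r h \<eta>) \<inter> dom (emb r h \<nu>)"
      using k(1,2) assms by (simp add: emb_h dom_def)
    moreover have "the (emb r h \<eta> (h k)) < the (emb r h \<nu> (h k))" using k(4) assms by (simp add: emb_h)
    ultimately show ?L by blast
  qed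
  thus ?thesis using emb_ext_iff[OF assms] emb_eq_iff[OF assms] by (simp add: node_lex_def)
qed

lemma emb_shorter_iff:
  "node_shorter r (emb r h \<eta>) (emb r h \<nu>) \<longleftrightarrow> node_shorter natLeq \<eta> \<nu>"
  using h_less_iff[of "len \<eta>" "len \<nu>"]
  by (auto simp: node_shorter_def node_len_emb underS_def natLeq_def h_eq_iff)

text \<open>Both images agree below \<open>h k\<close>, where \<open>k\<close> is the length of the
  meet, and they part exactly there: either one image ends at \<open>h k\<close>, or the values at
  \<open>h k\<close> differ.\<close>

lemma emb_meet:
  assumes "\<eta> \<in> tree natLeq" "\<nu> \<in> tree natLeq"
  shows "node_meet r (emb r h \<eta>) (emb r h \<nu>) = emb r h (node_meet natLeq \<eta> \<nu>)"
proof -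
  obtain k where k: "dom (node_meet natLeq \<eta> \<nu>) = {..<k}" "k \<le> len \<eta>" "k \<le> len \<nu>"
    "\<And>j. j < k \<Longrightarrow> \<eta> j = \<nu> j" "\<And>j. j < k \<Longrightarrow> node_meet natLeq \<eta> \<nu> j = \<eta> j"
    "k < len \<eta> \<Longrightarrow> k < len \<nu> \<Longrightarrow> \<eta> k \<noteq> \<nu> k"
    using node_meet_natLeq[OF assms] by blast
  note meet = tree_natLeqI[OF k(1)]
  let ?D = "{i \<in> dom (emb r h \<eta>) \<inter> dom (emb r h \<nu>). \<forall>j\<in>under r i. emb r h \<eta> j = emb r h \<nu> j}"
  have "?D = underS r (h k)"
  proof (intro equalityI subsetI)
    fix \<delta> assume \<delta>: "\<delta> \<in> ?D"
    show "\<delta> \<in> underS r (h k)"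
    proof (rule ccontr)
      \<comment> \<open>Then the images agree at \<open>h k\<close> and both extend beyond it, so
        \<eta> and \<nu> have equal entries at \<open>k\<close>, against
        \<open>k(6)\<close>.\<close>
      assume "\<delta> \<notin> underS r (h k)"
      moreover have "\<delta> \<in> Field r" using \<delta> by (auto simp: dom_emb underS_def Field_def)
      ultimately have hk: "(h k, \<delta>) \<in> r"
        using wo_rel.TOTALS[unfolded wo_rel_def, OF wo] wo_rel.REFL[unfolded wo_rel_def, OF wo] h_Field
        by (auto simp: underS_def refl_on_def)
      hence "emb r h \<eta> (h k) = emb r h \<nu> (h k)" using \<delta> by (auto simp: under_def)
      moreover have "h k \<in> underS r (h (len \<eta>))" "h k \<in> underS r (h (len \<nu>))"
        using \<delta> hk underS_down by (auto simp: dom_emb)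
      ultimately show False using k(6) assms by (simp add: emb_h h_less_iff)
    qed
  next
    fix \<delta> assume \<delta>: "\<delta> \<in> underS r (h k)"
    have "emb r h \<eta> j = emb r h \<nu> j" if "j \<in> under r \<delta>" for j
      using emb_agree[OF assms k(2,3,4)] underS_down[OF \<delta>] that by (simp add: under_def)
    thus "\<delta> \<in> ?D" using \<delta> underS_mono k(2,3) by (auto simp: dom_emb)
  qed
  moreover have "emb r h \<eta> \<delta> = emb r h (node_meet natLeq \<eta> \<nu>) \<delta>" if "\<delta> \<in> underS r (h k)" for \<delta>
    by (rule emb_agree[OF assms(1) meet(1) k(2)]) (use meet(2) k(5) that in auto)
  moreover have "emb r h (node_meet natLeq \<eta> \<nu>) \<delta> = None" if "\<delta> \<notin> underS r (h k)" for \<delta>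
    using that meet(2) by (simp add: emb_def)
  ultimately show ?thesis unfolding node_meet_def[of r] by (auto simp: restrict_map_def)
qed

end

text \<open>There are infinitely many terms, but the length bound leaves only finitely many levels
  for their values; this provides the \<open>K\<close> of \<open>matching_levels\<close>.\<close>

lemma tm_val_natLeq:
  assumes "set \<eta>s \<subseteq> tree natLeq" "tm_vars t \<subseteq> {..<length \<eta>s}"
  shows "tm_val natLeq \<eta>s t \<in> tree natLeq \<and> (\<exists>\<eta>\<in>set \<eta>s. len (tm_val natLeq \<eta>s t) \<le> len \<eta>)"
  using assms(2)
proof (induction t)
  case (TVar n)
  hence "\<eta>s ! n \<in> set \<eta>s" by simp
  then show ?case using assms(1) by auto
next
  case (TMeet s t)
  hence st: "tm_val natLeq \<eta>s s \<in> tree natLeq" "tm_val natLeq \<eta>s t \<in> tree natLeq" by auto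
  obtain k where "dom (node_meet natLeq (tm_val natLeq \<eta>s s) (tm_val natLeq \<eta>s t)) = {..<k}"
    "k \<le> len (tm_val natLeq \<eta>s s)"
    by (rule node_meet_natLeq[OF st])
  moreover obtain \<eta> where "\<eta> \<in> set \<eta>s" "len (tm_val natLeq \<eta>s s) \<le> len \<eta>" using TMeet by auto
  ultimately show ?case using tree_natLeqI by (auto intro!: bexI[of _ \<eta>])
qed

context level_embedding
begin

lemma tm_val_emb:
  assumes "set \<eta>s \<subseteq> tree natLeq" "tm_vars t \<subseteq> {..<length \<eta>s}"
  shows "tm_val r (map (emb r h) \<eta>s) t = emb r h (tm_val natLeq \<eta>s t)"
  using assms(2)
proof (induction t)
  case (TMeet s t)
  then show ?case using emb_meet tm_val_natLeq[OF assms(1)] by simp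
qed simp

lemma str_true_emb:
  assumes "set \<eta>s \<subseteq> tree natLeq" "str_vars A \<subseteq> {..<length \<eta>s}"
  shows "str_true r (map (emb r h) \<eta>s) A \<longleftrightarrow> str_true natLeq \<eta>s A"
  using assms(2)
  by (cases A) (simp_all add: tm_val_emb[OF assms(1)] tm_val_natLeq[OF assms(1)]
      emb_eq_iff emb_ext_iff emb_lex_iff emb_shorter_iff)

lemma str_qf_equiv_emb:
  assumes "set \<eta>s \<subseteq> tree natLeq"
  shows "str_qf_equiv r (map (emb r h) \<eta>s) natLeq \<eta>s"
  using str_true_emb[OF assms] by (intro str_qf_equivI) auto

end

text \<open>The two languages differ in how they speak of levels: the one compares lengths, the
  other names them. All other atoms transfer through the embeddings. Two level maps are allowed
  because the tuples may use different levels of the same order pattern, and \<open>lev\<close> asks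
  that the maps bring these together.\<close>

lemma s_qf_equiv_emb:
  fixes r :: "'i rel"
  assumes "Well_order r" "increasing r h" "increasing r h'"
    and \<eta>s: "set \<eta>s \<subseteq> tree natLeq" and \<nu>s: "set \<nu>s \<subseteq> tree natLeq"
    and eq: "str_qf_equiv natLeq \<eta>s natLeq \<nu>s"
    and lev: "\<And>t. tm_vars t \<subseteq> {..<length \<eta>s} \<Longrightarrow>
      h (len (tm_val natLeq \<eta>s t)) = h' (len (tm_val natLeq \<nu>s t))"
  shows "s_qf_equiv r (map (emb r h) \<eta>s) (map (emb r h') \<nu>s)"
proof -
  interpret A: level_embedding r h using assms by unfold_locales
  interpret B: level_embedding r h' using assms by unfold_locales
  have l: "length \<eta>s = length \<nu>s" using eq by (simp add: str_qf_equiv_def)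
  have D: "str_true natLeq \<eta>s A \<longleftrightarrow> str_true natLeq \<nu>s A" if "str_vars A \<subseteq> {..<length \<nu>s}" for A
    using str_qf_equivD[OF eq] that l by simp
  show ?thesis
  proof (rule s_qf_equivI)
    fix A :: "'i s_atom" assume A: "s_vars A \<subseteq> {..<length (map (emb r h') \<nu>s)}"
    note vals = A.tm_val_emb[OF \<eta>s] B.tm_val_emb[OF \<nu>s] tm_val_natLeq[OF \<eta>s] tm_val_natLeq[OF \<nu>s]
    show "s_true r (map (emb r h) \<eta>s) A \<longleftrightarrow> s_true r (map (emb r h') \<nu>s) A"
    proof (cases A)
      case (SEq s t)
      then show ?thesis using A D[of "StrEq s t"] l by (simp add: vals A.emb_eq_iff B.emb_eq_iff)
    next
      case (SExt s t)
      then show ?thesis using A D[of "StrExt s t"] l by (simp add: vals A.emb_ext_iff B.emb_ext_iff)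
    next
      case (SLex s t)
      then show ?thesis using A D[of "StrLex s t"] l by (simp add: vals A.emb_lex_iff B.emb_lex_iff)
    next
      case (SLevel \<gamma> t)
      then show ?thesis using A lev[of t] l by (simp add: vals A.node_len_emb B.node_len_emb)
    qed
  qed (use l in simp)
qed

text \<open>The levels used by the two tuples form finite sets of the same order type. Both
  \<open>f\<close> and \<open>g\<close> send the element of rank \<open>n\<close> in the respective
  set to \<open>K * n\<close>, and multiples of \<open>K\<close> leave enough room for the numbers
  in between.\<close>

lemma matching_levels:
  fixes l l' :: "'t \<Rightarrow> nat"
  assumes bound: "\<And>t. t \<in> T \<Longrightarrow> l t < K \<and> l' t < K"
    and iff: "\<And>s t. s \<in> T \<Longrightarrow> t \<in> T \<Longrightarrow> l s < l t \<longleftrightarrow> l' s < l' t"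
  shows "\<exists>f g :: nat \<Rightarrow> nat. strict_mono f \<and> strict_mono g \<and> (\<forall>t\<in>T. f (l t) = g (l' t))"
proof -
  define c where "c = (\<lambda>S x. card {m \<in> S. m \<le> (x :: nat)})"
  \<comment> \<open>\<open>c S x\<close> is the number of elements of \<open>S\<close> up to
    \<open>x\<close>. A number \<open>x < K\<close> outside \<open>S\<close> is shifted by itself,
    which stays below the next multiple of \<open>K\<close>; from \<open>K\<close> on, the constant
    \<open>K * K + K\<close> clears all earlier values.\<close>
  define f where "f = (\<lambda>S x. if x < K then K * c S x + (if x \<in> S then 0 else x) else K * K + K + x)"
  have mono: "strict_mono (f S)" if "S \<subseteq> {..<K}" for S
    unfolding strict_mono_Suc_iff
  proof
    fix x
    have "c S x \<le> card {..<K}" unfolding c_def using that by (intro card_mono) auto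
    hence "K * c S x \<le> K * K" by simp
    hence cK: "K * c S x + x < K * K + K + Suc x" "K * c S x < K * K + K + Suc x" by linarith+
    have "c S (Suc x) = c S x + (if Suc x \<in> S then 1 else 0)"
    proof (cases "Suc x \<in> S")
      case True
      hence "{m \<in> S. m \<le> Suc x} = insert (Suc x) {m \<in> S. m \<le> x}" by (auto simp: le_Suc_eq)
      then show ?thesis using True by (simp add: c_def)
    next
      case False
      hence "{m \<in> S. m \<le> Suc x} = {m \<in> S. m \<le> x}" by (auto simp: le_Suc_eq)
      then show ?thesis using False by (simp add: c_def)
    qed
    thus "f S x < f S (Suc x)" using cK by (cases "x < K"; cases "Suc x < K") (auto simp: f_def)
  qed
  have "f (l ` T) (l t) = f (l' ` T) (l' t)" if t: "t \<in> T" for t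
  proof -
    let ?S = "{s \<in> T. l s \<le> l t}"
    have le: "?S = {s \<in> T. l' s \<le> l' t}" using iff t by (auto simp: not_less[symmetric])
    have eq: "l s = l s' \<longleftrightarrow> l' s = l' s'" if "s \<in> T" "s' \<in> T" for s s'
      using iff[of s s'] iff[of s' s] that by auto
    \<comment> \<open>Two levels are equal if neither is smaller, so equality transfers as well.
      Hence \<phi> is a well-defined bijection between the levels up to \<open>t\<close>, and the
      ranks of \<open>l t\<close> and \<open>l' t\<close> coincide.\<close>
    obtain \<phi> where \<phi>: "\<And>s. s \<in> T \<Longrightarrow> \<phi> (l s) = l' s"
    proof (rule that)
      fix s assume s: "s \<in> T"
      have "(SOME u. u \<in> T \<and> l u = l s) \<in> T \<and> l (SOME u. u \<in> T \<and> l u = l s) = l s"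
        by (rule someI[of _ s]) (use s in auto)
      thus "(\<lambda>x. l' (SOME u. u \<in> T \<and> l u = x)) (l s) = l' s"
        using eq[of "SOME u. u \<in> T \<and> l u = l s" s] s by simp
    qed
    have "inj_on \<phi> (l ` ?S)" using \<phi> eq by (auto simp: inj_on_def)
    moreover have "\<phi> ` l ` ?S = l' ` ?S" unfolding image_image by (rule image_cong) (use \<phi> in auto)
    ultimately have "card (l ` ?S) = card (l' ` ?S)" using card_image[of \<phi> "l ` ?S"] by simp
    moreover have "{m \<in> l ` T. m \<le> l t} = l ` ?S" by auto
    moreover have "{m \<in> l' ` T. m \<le> l' t} = l' ` ?S" unfolding le by auto
    ultimately have "c (l ` T) (l t) = c (l' ` T) (l' t)" by (simp add: c_def)
    thus ?thesis using bound t by (simp add: f_def)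
  qed
  moreover have "strict_mono (f (l ` T))" "strict_mono (f (l' ` T))" using bound by (auto intro!: mono)
  ultimately show ?thesis by blast
qed

lemma str_equiv_imp_s_equiv_emb:
  assumes "Well_order r" "increasing r h"
    and \<eta>s: "set \<eta>s \<subseteq> tree natLeq" and \<nu>s: "set \<nu>s \<subseteq> tree natLeq"
    and eq: "str_qf_equiv natLeq \<eta>s natLeq \<nu>s"
  obtains f g :: "nat \<Rightarrow> nat" where "strict_mono f" "strict_mono g"
    "s_qf_equiv r (map (emb r (h \<circ> f)) \<eta>s) (map (emb r (h \<circ> g)) \<nu>s)"
proof -
  define T where "T = {t. tm_vars t \<subseteq> {..<length \<eta>s}}"
  let ?l = "\<lambda>t. len (tm_val natLeq \<eta>s t)" and ?l' = "\<lambda>t. len (tm_val natLeq \<nu>s t)"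
  have l: "length \<eta>s = length \<nu>s" using eq by (simp add: str_qf_equiv_def)
  let ?K = "Suc (sum_list (map len (\<eta>s @ \<nu>s)))"
  have K: "len \<eta> < ?K" if "\<eta> \<in> set \<eta>s \<union> set \<nu>s" for \<eta>
    using member_le_sum_list[of "len \<eta>" "map len (\<eta>s @ \<nu>s)"] that by auto
  have bound: "?l t < ?K \<and> ?l' t < ?K" if "t \<in> T" for t
  proof -
    have "tm_vars t \<subseteq> {..<length \<eta>s}" "tm_vars t \<subseteq> {..<length \<nu>s}" using that l by (auto simp: T_def)
    then obtain \<eta> \<nu> where "\<eta> \<in> set \<eta>s" "?l t \<le> len \<eta>" "\<nu> \<in> set \<nu>s" "?l' t \<le> len \<nu>"
      using tm_val_natLeq[OF \<eta>s] tm_val_natLeq[OF \<nu>s] by blast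
    thus ?thesis using K[of \<eta>] K[of \<nu>] by auto
  qed
  have iff: "?l s < ?l t \<longleftrightarrow> ?l' s < ?l' t" if "s \<in> T" "t \<in> T" for s t
    using str_qf_equivD[OF eq, of "StrLen s t"] that by (auto simp: T_def node_shorter_def natLeq_def)
  have "\<exists>f g :: nat \<Rightarrow> nat. strict_mono f \<and> strict_mono g \<and> (\<forall>t\<in>T. f (?l t) = g (?l' t))"
    by (rule matching_levels[of T ?l ?K ?l', OF bound iff])
  then obtain f g :: "nat \<Rightarrow> nat" where fg: "strict_mono f" "strict_mono g"
    "\<forall>t\<in>T. f (?l t) = g (?l' t)" by (elim exE conjE)
  have "s_qf_equiv r (map (emb r (h \<circ> f)) \<eta>s) (map (emb r (h \<circ> g)) \<nu>s)"
  proof (rule s_qf_equiv_emb[OF assms(1) _ _ \<eta>s \<nu>s eq])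
    show "increasing r (h \<circ> f)" "increasing r (h \<circ> g)" by (rule increasing_comp[OF assms(2)]; fact fg)+
    show "(h \<circ> f) (?l t) = (h \<circ> g) (?l' t)" if "tm_vars t \<subseteq> {..<length \<eta>s}" for t
      using fg(3) that by (simp add: T_def)
  qed
  thus ?thesis by (rule that[OF fg(1,2)])
qed

section \<open>Colouring finite sets of levels by types of subtrees\<close>

section \<open>Homogeneous levels\<close>

lemma infinite_subset_increasing:
  assumes wo: "Well_order r" and Y: "Y \<subseteq> Field r" "infinite Y"
  obtains h where "increasing r h" "range h \<subseteq> Y"
proof -
  have "well_order_on Y (Restr r Y)" using well_order_on_Restr[OF wo Y(1)] .
  hence "|Y| \<le>o Restr r Y" by (rule card_of_least)
  moreover have "natLeq \<le>o |Y|" using Y(2) infinite_iff_natLeq_ordLeq by blast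
  ultimately have "natLeq \<le>o Restr r Y" by (rule ordLeq_transitive[rotated])
  then obtain h where h: "embed natLeq (Restr r Y) h" unfolding ordLeq_def by auto
  have W: "Well_order (Restr r Y)" using wo by (rule Well_order_Restr)
  have inj: "inj_on h (Field natLeq)" using embed_inj_on[OF natLeq_Well_order h] .
  have comp: "compat natLeq (Restr r Y) h" using h by (rule embed_compat)
  have "h m \<in> underS r (h n)" if "m < n" for m n
  proof -
    have "(h m, h n) \<in> Restr r Y" using comp that by (auto simp: compat_def natLeq_def)
    moreover have "h m \<noteq> h n" using inj that by (auto simp: inj_on_def Field_natLeq)
    ultimately show ?thesis by (auto simp: underS_def)
  qed
  moreover have "range h \<subseteq> Y" using embed_Field[OF h] Field_Restr_subset[of r Y] by (auto simp: Field_natLeq)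
  ultimately show ?thesis using that[of h] by (simp add: increasing_def)
qed

text \<open>The element of \<open>s\<close> with exactly \<open>j\<close> predecessors in
  \<open>s\<close>, that is, the increasing enumeration from zero. It makes the colour depend on the
  set of levels alone.\<close>

definition en :: "'i rel \<Rightarrow> 'i set \<Rightarrow> nat \<Rightarrow> 'i" where
  "en r s j = (SOME x. x \<in> s \<and> card {y \<in> s. y \<in> underS r x} = j)"

lemma en_image:
  assumes "Well_order r" "increasing r h" "j < K"
  shows "en r (h ` {..<K}) j = h j"
proof -
  interpret level_embedding r h using assms by unfold_locales
  have card: "card {y \<in> h ` {..<K}. y \<in> underS r (h i)} = i" if "i < K" for i
  proof -
    have "{y \<in> h ` {..<K}. y \<in> underS r (h i)} = h ` {..<i}" using that by (auto simp: h_less_iff)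
    moreover have "inj_on h {..<i}" by (simp add: inj_on_def h_eq_iff)
    ultimately show ?thesis by (simp add: card_image)
  qed
  show ?thesis unfolding en_def
  proof (rule some_equality)
    show "h j \<in> h ` {..<K} \<and> card {y \<in> h ` {..<K}. y \<in> underS r (h j)} = j" using card assms(3) by auto
    fix x assume "x \<in> h ` {..<K} \<and> card {y \<in> h ` {..<K}. y \<in> underS r x} = j"
    thus "x = h j" using card by auto
  qed
qed

definition eval_at :: "('i node \<Rightarrow> 'k \<Rightarrow> 'm) \<Rightarrow> 'i rel \<Rightarrow> (nat \<Rightarrow> 'i) \<Rightarrow> (nat node \<times> 'k) + 'm \<Rightarrow> 'm" where
  "eval_at a r h = case_sum (\<lambda>(\<eta>, k). a (emb r h \<eta>) k) id"

text \<open>The colour of a finite set of levels is the type of the subtree on these levels, with finite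
  lists of parameters in place of the infinite substitutions of \<open>Pfm\<close>: there are too many of
  the latter.\<close>

definition level_colour ::
  "('f, 'r) signature \<Rightarrow> ('m, 'f, 'r) struct \<Rightarrow> 'k rel \<Rightarrow> 'm set \<Rightarrow> 'i rel \<Rightarrow> ('i node \<Rightarrow> 'k \<Rightarrow> 'm) \<Rightarrow>
     'i set \<Rightarrow> (('f, 'r) fm \<times> ((nat node \<times> 'k) + 'm) list) set" where
  "level_colour L M \<kappa> C r a s = {(\<phi>, ps). \<phi> \<in> Fm L \<and> ps \<in> lists ((tree natLeq \<times> Field \<kappa>) <+> C) \<and>
     holds M (\<lambda>i. eval_at a r (en r s) (ps ! i)) \<phi>}"

text \<open>On the first \<open>K\<close> levels \<open>en\<close> gives back \<open>h\<close>, and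
  these are all the levels that nodes of length less than \<open>K\<close> see. The substitution can
  be cut to a list of length \<open>fm_bound \<phi>\<close> without changing the truth of
  \<phi>.\<close>

lemma satisfies_level_colour:
  assumes wo: "Well_order r" and h: "increasing r h" and \<eta>s: "set \<eta>s \<subseteq> tree natLeq"
    and K: "\<And>\<eta>. \<eta> \<in> set \<eta>s \<Longrightarrow> len \<eta> < K"
    and p: "(\<phi>, \<sigma>) \<in> Pfm L ({..<length \<eta>s} \<times> Field \<kappa>) C"
  shows "satisfies M (tuple_at a (map (emb r h) \<eta>s)) (\<phi>, \<sigma>) \<longleftrightarrow>
    (\<phi>, map (\<lambda>i. map_sum (\<lambda>(n, k). (\<eta>s ! n, k)) id (\<sigma> i)) [0..<fm_bound \<phi>])
      \<in> level_colour L M \<kappa> C r a (h ` {..<K})"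
proof -
  let ?ps = "map (\<lambda>i. map_sum (\<lambda>(n, k). (\<eta>s ! n, k)) id (\<sigma> i)) [0..<fm_bound \<phi>]"
  have \<phi>: "\<phi> \<in> Fm L" and \<sigma>: "\<And>i. \<sigma> i \<in> ({..<length \<eta>s} \<times> Field \<kappa>) <+> C" using p by (auto simp: Pfm_def)
  have nth: "\<eta>s ! n \<in> tree natLeq" "len (\<eta>s ! n) < K" if "n < length \<eta>s" for n
    using \<eta>s K that by auto
  have "map_sum (\<lambda>(n, k). (\<eta>s ! n, k)) id (\<sigma> i) \<in> (tree natLeq \<times> Field \<kappa>) <+> C" for i
    using \<sigma>[of i] nth(1) by (auto elim!: PlusE)
  hence "?ps \<in> lists ((tree natLeq \<times> Field \<kappa>) <+> C)" by auto
  moreover have "holds M (case_sum (tuple_at a (map (emb r h) \<eta>s)) id \<circ> \<sigma>) \<phi> \<longleftrightarrow>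
    holds M (\<lambda>i. eval_at a r (en r (h ` {..<K})) (?ps ! i)) \<phi>"
  proof (rule holds_cong)
    fix i assume i: "i < fm_bound \<phi>"
    have "emb r (en r (h ` {..<K})) (\<eta>s ! n) = emb r h (\<eta>s ! n)" if "n < length \<eta>s" for n
      by (rule emb_cong) (use nth[OF that] en_image[OF wo h] in auto)
    thus "(case_sum (tuple_at a (map (emb r h) \<eta>s)) id \<circ> \<sigma>) i = eval_at a r (en r (h ` {..<K})) (?ps ! i)"
      using i \<sigma>[of i] by (auto elim!: PlusE simp: eval_at_def tuple_at_def)
  qed
  ultimately show ?thesis using \<phi> by (simp add: satisfies_def level_colour_def del: in_lists_conv_set)
qed

lemma same_type_level_colour:
  assumes "Well_order r" "increasing r h" "increasing r h'" and \<eta>s: "set \<eta>s \<subseteq> tree natLeq"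
    and K: "\<And>\<eta>. \<eta> \<in> set \<eta>s \<Longrightarrow> len \<eta> < K"
    and eq: "level_colour L M \<kappa> C r a (h ` {..<K}) = level_colour L M \<kappa> C r a (h' ` {..<K})"
  shows "same_type L M \<kappa> C a (map (emb r h) \<eta>s) a (map (emb r h') \<eta>s)"
proof -
  have "satisfies M (tuple_at a (map (emb r h) \<eta>s)) p \<longleftrightarrow> satisfies M (tuple_at a (map (emb r h') \<eta>s)) p"
    if p: "p \<in> Pfm L ({..<length \<eta>s} \<times> Field \<kappa>) C" for p
  proof (cases p)
    case (Pair \<phi> \<sigma>)
    let ?ps = "map (\<lambda>i. map_sum (\<lambda>(n, k). (\<eta>s ! n, k)) id (\<sigma> i)) [0..<fm_bound \<phi>]"
    have "satisfies M (tuple_at a (map (emb r h) \<eta>s)) (\<phi>, \<sigma>) \<longleftrightarrow>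
        (\<phi>, ?ps) \<in> level_colour L M \<kappa> C r a (h ` {..<K})"
      by (rule satisfies_level_colour[OF assms(1,2) \<eta>s K p[unfolded Pair]])
    moreover have "satisfies M (tuple_at a (map (emb r h') \<eta>s)) (\<phi>, \<sigma>) \<longleftrightarrow>
        (\<phi>, ?ps) \<in> level_colour L M \<kappa> C r a (h' ` {..<K})"
      by (rule satisfies_level_colour[OF assms(1,3) \<eta>s K p[unfolded Pair]])
    ultimately show ?thesis by (simp only: Pair eq)
  qed
  thus ?thesis by (auto simp: same_type_def positive_type_def)
qed

lemma card_of_tree_natLeq: "|tree natLeq| \<le>o natLeq"
proof -
  have "inj_on (\<lambda>\<eta>. map (\<lambda>i. the (\<eta> i)) [0..<len \<eta>]) (tree natLeq)"
  proof (rule inj_onI)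
    fix \<eta> \<nu> assume t: "\<eta> \<in> tree natLeq" "\<nu> \<in> tree natLeq"
      and eq: "map (\<lambda>i. the (\<eta> i)) [0..<len \<eta>] = map (\<lambda>i. the (\<nu> i)) [0..<len \<nu>]"
    have l: "len \<eta> = len \<nu>" using arg_cong[OF eq, of length] by simp
    hence d: "dom \<eta> = dom \<nu>" using t by (simp add: dom_natLeq)
    have "the (\<eta> i) = the (\<nu> i)" if "i < len \<eta>" for i
      using arg_cong[OF eq, of "\<lambda>xs. xs ! i"] that l by simp
    moreover have "i < len \<eta>" if "i \<in> dom \<eta>" for i using that dom_natLeq[OF t(1)] by auto
    ultimately have "\<eta> i = \<nu> i" if "i \<in> dom \<eta>" for i using that d by (metis domD option.sel)
    hence "\<eta> \<subseteq>\<^sub>m \<nu>" "\<nu> \<subseteq>\<^sub>m \<eta>" using d by (auto simp: map_le_def)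
    thus "\<eta> = \<nu>" by (rule map_le_antisym)
  qed
  hence "|tree natLeq| \<le>o |lists (UNIV :: nat set)|" by (rule card_of_ordLeqI) simp
  moreover have "|lists (UNIV :: nat set)| \<le>o natLeq"
    by (rule Card_order_lists_le[OF natLeq_Cinfinite]) (simp add: card_of_nat ordIso_imp_ordLeq)
  ultimately show ?thesis by (rule ordLeq_transitive)
qed

lemma natLeq_le_Fm: "natLeq \<le>o |Fm L|"
proof -
  have "inj (\<lambda>n. Eq (Var 0) (Var n) :: ('a, 'b) fm)" by (auto simp: inj_on_def)
  moreover have "range (\<lambda>n. Eq (Var 0) (Var n)) \<subseteq> Fm L" by (auto simp: Fm_def)
  ultimately have "infinite (Fm L)"
    by (metis finite_subset infinite_UNIV_nat finite_imageD)
  thus ?thesis using infinite_iff_natLeq_ordLeq by blast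
qed

lemma Cinfinite_Fm_csum: "Cinfinite ( |Fm L| +c r)"
  using cinfinite_mono[OF natLeq_le_Fm natLeq_cinfinite]
  by (intro Cinfinite_csum1 conjI card_of_Card_order)

text \<open>The sequence \<open>H n\<close> is homogeneous for sets of at most \<open>n\<close>
  levels, and the colour \<open>c K\<close> of a set of \<open>K\<close> levels is the same in all
  \<open>H n\<close> with \<open>K \<le> n\<close>. Thinning by \<open>f\<close> and
  \<open>g\<close> is harmless, as it picks other sets of \<open>K\<close> levels from the same
  homogeneous ranges.\<close>

lemma homogeneous_levels:
  fixes lam :: "'l rel" and \<kappa> :: "'k rel" and C :: "'m set" and L :: "('f, 'r) signature"
  assumes \<kappa>: "Card_order \<kappa>" and beth: "is_beth (cardSuc (ctwo ^c ( |Fm L| +c |C| +c \<kappa>))) lam"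
  shows "\<exists>H :: nat \<Rightarrow> nat \<Rightarrow> 'l. (\<forall>n. increasing lam (H n)) \<and>
    (\<forall>\<eta>s K m n f g. set \<eta>s \<subseteq> tree natLeq \<and> (\<forall>\<eta>\<in>set \<eta>s. len \<eta> < K) \<and>
      K \<le> m \<and> K \<le> n \<and> strict_mono f \<and> strict_mono g \<longrightarrow>
      same_type L M \<kappa> C a (map (emb lam (H m \<circ> f)) \<eta>s) a (map (emb lam (H n \<circ> g)) \<eta>s))"
proof -
  let ?\<sigma> = "|Fm L| +c |C| +c \<kappa>"
  let ?F = "level_colour L M \<kappa> C lam a"
  \<comment> \<open>Colours are subsets of this set, whose cardinal is at most that of
    \<open>?\<sigma>\<close>. So there are at most \<open>ctwo ^c ?\<sigma>\<close> of them, the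
    cardinal whose successor indexes the beth number.\<close>
  let ?P = "Fm L \<times> lists ((tree natLeq \<times> Field \<kappa>) <+> C)"
  have wo: "Well_order lam" using beth by (auto simp: is_beth_def card_order_on_def)
  have \<sigma>: "Cinfinite ?\<sigma>" by (rule Cinfinite_Fm_csum)
  have inf: "\<not> finite (Field ?\<sigma>)" "Card_order ?\<sigma>" using \<sigma> by (auto simp: cinfinite_def)
  have Fm: "|Fm L| \<le>o ?\<sigma>" by (intro ordLeq_csum1 card_of_Card_order)
  have rest: "|C| +c \<kappa> \<le>o ?\<sigma>" by (intro ordLeq_csum2 Card_order_csum)
  have "|C| \<le>o |C| +c \<kappa>" by (intro ordLeq_csum1 card_of_Card_order)
  hence C: "|C| \<le>o ?\<sigma>" using rest by (rule ordLeq_transitive)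
  have "|Field \<kappa>| =o \<kappa>" using \<kappa> by (rule card_of_Field_ordIso)
  moreover have "\<kappa> \<le>o |C| +c \<kappa>" using \<kappa> by (rule ordLeq_csum2)
  ultimately have "|Field \<kappa>| \<le>o |C| +c \<kappa>" by (rule ordIso_ordLeq_trans)
  hence k: "|Field \<kappa>| \<le>o ?\<sigma>" using rest by (rule ordLeq_transitive)
  have "natLeq \<le>o ?\<sigma>" using natLeq_le_Fm Fm by (rule ordLeq_transitive)
  with card_of_tree_natLeq have tr: "|tree natLeq| \<le>o ?\<sigma>" by (rule ordLeq_transitive)
  have "|tree natLeq \<times> Field \<kappa>| \<le>o ?\<sigma>" using inf tr k by (intro card_of_Times_ordLeq_infinite_Field)
  hence "|(tree natLeq \<times> Field \<kappa>) <+> C| \<le>o ?\<sigma>" using inf C by (intro card_of_Plus_ordLeq_infinite_Field)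
  hence "|lists ((tree natLeq \<times> Field \<kappa>) <+> C)| \<le>o ?\<sigma>" by (rule Card_order_lists_le[OF \<sigma>])
  hence P: "|?P| \<le>o ?\<sigma>" using inf Fm by (intro card_of_Times_ordLeq_infinite_Field)
  have "|Pow ?P| =o ctwo ^c |?P|" unfolding ctwo_def cexp_def Field_card_of by (rule card_of_Pow_Func)
  moreover have "ctwo ^c |?P| \<le>o ctwo ^c ?\<sigma>"
  proof (rule cexp_mono2_Cnotzero[OF P Card_order_ctwo])
    have "(Top, []) \<in> ?P" by (simp add: Fm_def)
    thus "Cnotzero |?P|" by (metis card_of_Card_order card_of_ordIso_czero_iff_empty empty_iff)
  qed
  ultimately have Col: "|Pow ?P| \<le>o ctwo ^c ?\<sigma>" by (rule ordIso_ordLeq_trans)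
  have "Cinfinite (ctwo ^c ?\<sigma>)" using \<sigma> by (simp add: Cinfinite_cexp ordLeq_refl Card_order_ctwo)
  moreover have "range ?F \<subseteq> Pow ?P" by (auto simp: level_colour_def)
  ultimately obtain c where c: "\<And>n. \<exists>Y\<subseteq>Field lam. infinite Y \<and>
      (\<forall>s\<subseteq>Y. finite s \<and> card s < n \<longrightarrow> ?F s = c (card s))"
    using homogeneous_below_beth[OF beth _ _ Col, of ?F] by auto
  have "\<exists>h. increasing lam h \<and> (\<forall>s\<subseteq>range h. finite s \<and> card s \<le> n \<longrightarrow> ?F s = c (card s))" for n
  proof -
    obtain Y where Y: "Y \<subseteq> Field lam" "infinite Y"
      "\<forall>s\<subseteq>Y. finite s \<and> card s < Suc n \<longrightarrow> ?F s = c (card s)" using c[of "Suc n"] by blast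
    obtain h where "increasing lam h" "range h \<subseteq> Y" by (rule infinite_subset_increasing[OF wo Y(1,2)])
    thus ?thesis using Y(3) by (intro exI[of _ h]) (auto simp: less_Suc_eq_le)
  qed
  then obtain H where H: "\<And>n. increasing lam (H n)"
    "\<And>n s. s \<subseteq> range (H n) \<Longrightarrow> finite s \<Longrightarrow> card s \<le> n \<Longrightarrow> ?F s = c (card s)"
    by metis
  have col: "?F ((H n \<circ> f) ` {..<K}) = c K" if "K \<le> n" "strict_mono f" for K n f
  proof -
    interpret level_embedding lam "H n" using wo H(1) by unfold_locales
    have "inj_on (H n \<circ> f) {..<K}"
      using strict_mono_eq[OF that(2)] by (auto simp: inj_on_def h_eq_iff)
    from card_image[OF this] have "card ((H n \<circ> f) ` {..<K}) = K" by (simp only: card_lessThan)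
    moreover have "(H n \<circ> f) ` {..<K} \<subseteq> range (H n)" by auto
    ultimately show ?thesis using H(2)[of "(H n \<circ> f) ` {..<K}" n] that(1) by simp
  qed
  show ?thesis
  proof (intro exI[of _ H] conjI allI impI, rule H(1), elim conjE)
    fix \<eta>s K m n and f g :: "nat \<Rightarrow> nat"
    assume \<eta>s: "set \<eta>s \<subseteq> tree natLeq" "\<forall>\<eta>\<in>set \<eta>s. len \<eta> < K"
      and m: "K \<le> m" "strict_mono f" and n: "K \<le> n" "strict_mono g"
    have "?F ((H m \<circ> f) ` {..<K}) = ?F ((H n \<circ> g) ` {..<K})"
      using col[OF m] col[OF n] by (rule trans[OF _ sym])
    thus "same_type L M \<kappa> C a (map (emb lam (H m \<circ> f)) \<eta>s) a (map (emb lam (H n \<circ> g)) \<eta>s)"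
      using \<eta>s by (intro same_type_level_colour[OF wo increasing_comp[OF H(1) m(2)] increasing_comp[OF H(1) n(2)]]) auto
  qed
qed

section \<open>Realising the limit type\<close>

lemma satisfies_reindex:
  "satisfies M c (\<phi>, map_sum \<rho> id \<circ> \<sigma>) \<longleftrightarrow> satisfies M (c \<circ> \<rho>) (\<phi>, \<sigma>)"
proof -
  have "(case_sum c id \<circ> (map_sum \<rho> id \<circ> \<sigma>)) i = (case_sum (c \<circ> \<rho>) id \<circ> \<sigma>) i" for i
    by (cases "\<sigma> i") auto
  hence "case_sum c id \<circ> (map_sum \<rho> id \<circ> \<sigma>) = case_sum (c \<circ> \<rho>) id \<circ> \<sigma>" by (rule ext)
  thus ?thesis unfolding satisfies_def fst_conv snd_conv by (rule arg_cong)
qed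

lemma satisfies_cong:
  assumes "(\<phi>, \<sigma>) \<in> Pfm L J C" "\<And>j. j \<in> J \<Longrightarrow> x j = y j"
  shows "satisfies M x (\<phi>, \<sigma>) \<longleftrightarrow> satisfies M y (\<phi>, \<sigma>)"
proof -
  have "(case_sum x id \<circ> \<sigma>) i = (case_sum y id \<circ> \<sigma>) i" for i
  proof -
    have "\<sigma> i \<in> J <+> C" using assms(1) by (auto simp: Pfm_def)
    thus ?thesis using assms(2) by (auto elim!: PlusE)
  qed
  hence "case_sum x id \<circ> \<sigma> = case_sum y id \<circ> \<sigma>" by (rule ext)
  thus ?thesis unfolding satisfies_def fst_conv snd_conv by (rule arg_cong)
qed

lemma same_type_sym: "same_type L M \<kappa> C a \<eta>s b \<nu>s \<Longrightarrow> same_type L M \<kappa> C b \<nu>s a \<eta>s"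
  unfolding same_type_def by metis

lemma same_type_trans [trans]:
  "same_type L M \<kappa> C a \<eta>s b \<nu>s \<Longrightarrow> same_type L M \<kappa> C b \<nu>s c \<xi>s \<Longrightarrow> same_type L M \<kappa> C a \<eta>s c \<xi>s"
  unfolding same_type_def by metis

lemma same_type_satisfies:
  assumes "same_type L M \<kappa> C a \<eta>s b \<nu>s" "p \<in> Pfm L ({..<length \<eta>s} \<times> Field \<kappa>) C"
  shows "satisfies M (tuple_at a \<eta>s) p \<longleftrightarrow> satisfies M (tuple_at b \<nu>s) p"
proof -
  have l: "length \<eta>s = length \<nu>s"
    using assms(1) unfolding same_type_def by (rule conjunct1)
  have eq: "positive_type L M C ({..<length \<eta>s} \<times> Field \<kappa>) (tuple_at a \<eta>s) =
      positive_type L M C ({..<length \<nu>s} \<times> Field \<kappa>) (tuple_at b \<nu>s)"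
    using assms(1) unfolding same_type_def by (rule conjunct2)
  have "p \<in> positive_type L M C ({..<length \<eta>s} \<times> Field \<kappa>) (tuple_at a \<eta>s) \<longleftrightarrow>
      p \<in> positive_type L M C ({..<length \<nu>s} \<times> Field \<kappa>) (tuple_at b \<nu>s)"
    by (simp only: eq)
  thus ?thesis using assms(2) unfolding positive_type_def l by blast
qed

text \<open>Since \<kappa> may be finite, the infinite \<open>|Fm L|\<close> is added first; the sum
  then absorbs the countable tree and stays below \<mu>.\<close>

lemma small_tree_tuple:
  assumes \<mu>: "Card_order \<mu>" "|Fm L| <o \<mu>" and \<kappa>: "Card_order \<kappa>" "\<kappa> <o \<mu>"
  shows "|tree natLeq \<times> Field \<kappa>| <o \<mu>"
proof -
  let ?\<sigma> = "|Fm L <+> Field \<kappa>|"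
  have k: "|Field \<kappa>| =o \<kappa>" using \<kappa>(1) by (rule card_of_Field_ordIso)
  have inf: "infinite (Fm L)" using natLeq_le_Fm[of L] infinite_iff_natLeq_ordLeq by blast
  have "|Fm L| \<le>o |Field \<mu>|" using \<mu> ordLess_imp_ordLeq card_of_mono2 by (metis Field_card_of)
  hence "\<not> finite (Field \<mu>)" using inf by (rule card_of_ordLeq_infinite)
  hence "?\<sigma> <o \<mu>"
    using \<mu> k \<kappa>(2) by (intro card_of_Plus_ordLess_infinite_Field) (auto intro: ordIso_ordLess_trans)
  moreover have "|tree natLeq \<times> Field \<kappa>| \<le>o ?\<sigma>"
  proof (rule card_of_Times_ordLeq_infinite_Field)
    show "infinite (Field ?\<sigma>)" using inf by (simp add: Field_card_of)
    have "|tree natLeq| \<le>o |Fm L|" using card_of_tree_natLeq natLeq_le_Fm by (rule ordLeq_transitive)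
    thus "|tree natLeq| \<le>o ?\<sigma>" using card_of_Plus1 by (rule ordLeq_transitive)
    show "|Field \<kappa>| \<le>o ?\<sigma>" by (rule card_of_Plus2)
  qed (rule card_of_Card_order)
  ultimately show ?thesis by (rule ordLeq_ordLess_trans[rotated])
qed

text \<open>\<Sigma> collects the formulas that hold in \<open>A n\<close> from some
  \<open>n\<close> on, so any finite part holds in \<open>A n\<close> for a single large
  \<open>n\<close>. On each finite tuple the types of the trees \<open>A n\<close> are eventually
  constant, and this constant type is contained in that of the realisation.\<close>

lemma limit_tree_exists:
  fixes M :: "('m, 'f, 'r) struct" and \<mu> :: "'s rel" and \<kappa> :: "'k rel" and A :: "nat \<Rightarrow> nat node \<Rightarrow> 'k \<Rightarrow> 'm"
  assumes T: "positive_theory L T" and M: "monster L T \<mu> M" and C: "C \<subseteq> dom_of M" "|C| <o \<mu>"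
    and \<kappa>: "Card_order \<kappa>" "\<kappa> <o \<mu>"
    and A: "\<And>n. is_tuple_tree M \<kappa> natLeq (A n)"
    and limit: "\<And>\<eta>s. set \<eta>s \<subseteq> tree natLeq \<Longrightarrow> \<exists>K. \<forall>n\<ge>K. same_type L M \<kappa> C (A K) \<eta>s (A n) \<eta>s"
  shows "\<exists>b. is_tuple_tree M \<kappa> natLeq b \<and>
    (\<forall>\<eta>s. set \<eta>s \<subseteq> tree natLeq \<longrightarrow> (\<exists>K. \<forall>n\<ge>K. same_type L M \<kappa> C b \<eta>s (A n) \<eta>s))"
proof -
  let ?V = "tree natLeq \<times> Field \<kappa>"
  have M': "Card_order \<mu>" "|Fm L| <o \<mu>" "existentially_closed L T M" "saturated L \<mu> M"
    using M by (auto simp: monster_def)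
  have small: "|?V| <o \<mu>" using M'(1,2) \<kappa> by (rule small_tree_tuple)
  hence "|?V| \<le>o |Field \<mu>|" using ordLess_imp_ordLeq card_of_mono2 by (metis Field_card_of)
  \<comment> \<open>\<open>saturated\<close> takes variables from \<open>Field \<mu>\<close>, so the
    pairs of a node and a coordinate are renamed into it.\<close>
  then obtain \<iota> where \<iota>: "inj_on \<iota> ?V" "\<iota> ` ?V \<subseteq> Field \<mu>" unfolding card_of_ordLeq[symmetric] by blast
  let ?J = "\<iota> ` ?V"
  define B where "B = (\<lambda>n j. case inv_into ?V \<iota> j of (\<eta>, k) \<Rightarrow> A n \<eta> k)"
  have B: "B n (\<iota> (\<eta>, k)) = A n \<eta> k" if "\<eta> \<in> tree natLeq" "k \<in> Field \<kappa>" for n \<eta> k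
    using inv_into_f_f[OF \<iota>(1), of "(\<eta>, k)"] that by (simp add: B_def)
  have B_dom: "B n ` ?J \<subseteq> dom_of M" for n using A[of n] by (auto simp: B is_tuple_tree_def)
  define \<Sigma> where "\<Sigma> = {p \<in> Pfm L ?J C. \<exists>K. \<forall>n\<ge>K. satisfies M (B n) p}"
  have "\<exists>b0. b0 ` ?J \<subseteq> dom_of M \<and> (\<forall>p\<in>\<Sigma>. satisfies M b0 p)"
  proof (rule M'(4)[unfolded saturated_def, rule_format])
    have "|?J| <o \<mu>" using card_of_image small by (rule ordLeq_ordLess_trans)
    thus "C \<subseteq> dom_of M \<and> |C| <o \<mu> \<and> ?J \<subseteq> Field \<mu> \<and> |?J| <o \<mu> \<and> \<Sigma> \<subseteq> Pfm L ?J C"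
      using C \<iota>(2) by (auto simp: \<Sigma>_def)
    fix \<Sigma>0 assume \<Sigma>0: "finite \<Sigma>0 \<and> \<Sigma>0 \<subseteq> \<Sigma>"
    hence "\<forall>p\<in>\<Sigma>0. \<exists>K. \<forall>n\<ge>K. satisfies M (B n) p" by (auto simp: \<Sigma>_def)
    then obtain K where K: "\<And>p n. p \<in> \<Sigma>0 \<Longrightarrow> K p \<le> n \<Longrightarrow> satisfies M (B n) p" by metis
    \<comment> \<open>The sum of the thresholds is above each of them.\<close>
    have "satisfies M (B (\<Sum>p\<in>\<Sigma>0. K p)) p" if "p \<in> \<Sigma>0" for p
      using K[OF that] member_le_sum[of p \<Sigma>0 K] that \<Sigma>0 by simp
    thus "\<exists>a. a ` ?J \<subseteq> dom_of M \<and> (\<forall>p\<in>\<Sigma>0. satisfies M a p)" using B_dom by blast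
  qed
  then obtain b0 where b0: "b0 ` ?J \<subseteq> dom_of M" "\<forall>p\<in>\<Sigma>. satisfies M b0 p"
    by (elim exE conjE)
  define b where "b = (\<lambda>\<eta> k. b0 (\<iota> (\<eta>, k)))"
  have b: "is_tuple_tree M \<kappa> natLeq b" using b0(1) unfolding is_tuple_tree_def b_def by blast
  have "\<exists>K. \<forall>n\<ge>K. same_type L M \<kappa> C b \<eta>s (A n) \<eta>s" if \<eta>s: "set \<eta>s \<subseteq> tree natLeq" for \<eta>s
  proof -
    let ?I = "{..<length \<eta>s} \<times> Field \<kappa>"
    obtain K where K: "\<forall>n\<ge>K. same_type L M \<kappa> C (A K) \<eta>s (A n) \<eta>s" using limit[OF \<eta>s] ..
    have nth: "\<eta>s ! n \<in> tree natLeq" if "n < length \<eta>s" for n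
      using nth_mem[OF that] by (rule subsetD[OF \<eta>s])
    have tuple_dom: "tuple_at a' \<eta>s ` ?I \<subseteq> dom_of M" if "is_tuple_tree M \<kappa> natLeq a'" for a'
    proof -
      have "a' (\<eta>s ! n) k \<in> dom_of M" if "n < length \<eta>s" "k \<in> Field \<kappa>" for n k
        using \<open>is_tuple_tree M \<kappa> natLeq a'\<close> nth[OF that(1)] that(2) unfolding is_tuple_tree_def by blast
      thus ?thesis by (auto simp: tuple_at_def)
    qed
    \<comment> \<open>From places in the tuple to variables of the whole tree. A node may occur in
      \<open>\<eta>s\<close> more than once, so \<rho> need not be injective, and formulas are moved
      by substitution along it.\<close>
    define \<rho> where "\<rho> = (\<lambda>(n, k). \<iota> (\<eta>s ! n, k))"
    have \<rho>: "\<rho> j \<in> ?J" "(B n \<circ> \<rho>) j = tuple_at (A n) \<eta>s j" "(b0 \<circ> \<rho>) j = tuple_at b \<eta>s j"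
      if "j \<in> ?I" for j n
    proof -
      obtain i k where j: "j = (i, k)" "i < length \<eta>s" "k \<in> Field \<kappa>" using \<open>j \<in> ?I\<close> by auto
      have "\<eta>s ! i \<in> tree natLeq" using j(2) by (rule nth)
      thus "\<rho> j \<in> ?J" "(B n \<circ> \<rho>) j = tuple_at (A n) \<eta>s j" "(b0 \<circ> \<rho>) j = tuple_at b \<eta>s j"
        using j B by (auto simp: \<rho>_def tuple_at_def b_def)
    qed
    have "positive_type L M C ?I (tuple_at (A K) \<eta>s) \<subseteq> positive_type L M C ?I (tuple_at b \<eta>s)"
    proof
      fix p assume p: "p \<in> positive_type L M C ?I (tuple_at (A K) \<eta>s)"
      obtain \<phi> \<sigma> where p_eq: "p = (\<phi>, \<sigma>)" by (cases p)
      have P: "(\<phi>, \<sigma>) \<in> Pfm L ?I C" and sat: "satisfies M (tuple_at (A K) \<eta>s) (\<phi>, \<sigma>)"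
        using p by (auto simp: positive_type_def p_eq)
      have "map_sum \<rho> id (\<sigma> i) \<in> ?J <+> C" for i
      proof -
        have "\<sigma> i \<in> ?I <+> C" using P by (auto simp: Pfm_def)
        thus ?thesis using \<rho>(1) by (elim PlusE) (simp_all add: InlI InrI)
      qed
      hence P': "(\<phi>, map_sum \<rho> id \<circ> \<sigma>) \<in> Pfm L ?J C" using P unfolding Pfm_def by auto
      have "satisfies M (B n) (\<phi>, map_sum \<rho> id \<circ> \<sigma>)" if "n \<ge> K" for n
      proof -
        have "satisfies M (tuple_at (A n) \<eta>s) (\<phi>, \<sigma>)"
          using same_type_satisfies[OF K[rule_format, OF that] P] sat by simp
        moreover have "satisfies M (B n \<circ> \<rho>) (\<phi>, \<sigma>) \<longleftrightarrow> satisfies M (tuple_at (A n) \<eta>s) (\<phi>, \<sigma>)"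
          by (rule satisfies_cong[OF P]) (rule \<rho>(2))
        ultimately show ?thesis by (simp only: satisfies_reindex)
      qed
      hence "(\<phi>, map_sum \<rho> id \<circ> \<sigma>) \<in> \<Sigma>" using P' by (auto simp: \<Sigma>_def)
      hence "satisfies M b0 (\<phi>, map_sum \<rho> id \<circ> \<sigma>)" by (rule b0(2)[rule_format])
      moreover have "satisfies M (b0 \<circ> \<rho>) (\<phi>, \<sigma>) \<longleftrightarrow> satisfies M (tuple_at b \<eta>s) (\<phi>, \<sigma>)"
        by (rule satisfies_cong[OF P]) (rule \<rho>(3))
      ultimately have "satisfies M (tuple_at b \<eta>s) (\<phi>, \<sigma>)" by (simp only: satisfies_reindex)
      thus "p \<in> positive_type L M C ?I (tuple_at b \<eta>s)" using P by (simp add: positive_type_def p_eq)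
    qed
    hence "positive_type L M C ?I (tuple_at (A K) \<eta>s) = positive_type L M C ?I (tuple_at b \<eta>s)"
      by (rule positive_type_maximal[OF T M'(3) C(1) tuple_dom[OF A] tuple_dom[OF b]])
    hence "same_type L M \<kappa> C b \<eta>s (A K) \<eta>s" by (simp add: same_type_def)
    hence "\<forall>n\<ge>K. same_type L M \<kappa> C b \<eta>s (A n) \<eta>s" using K by (blast intro: same_type_trans)
    thus ?thesis ..
  qed
  thus ?thesis using b by blast
qed

theorem theorem4p8:
  fixes L :: "('f, 'r) signature"
    and T :: "('f, 'r) h_inductive set"
    and M :: "('m, 'f, 'r) struct"
    and \<mu> :: "'s rel"
    and C :: "'m set"
    and \<kappa> :: "'k rel"
    and lam :: "'l rel"
    and a :: "'l node \<Rightarrow> 'k \<Rightarrow> 'm"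
  assumes "positive_theory L T"
    and "monster L T \<mu> M"
    and "C \<subseteq> dom_of M" and "|C| <o \<mu>"
    and "Card_order \<kappa>" and "\<kappa> <o \<mu>"
    and "is_beth (cardSuc (ctwo ^c ( |Fm L| +c |C| +c \<kappa>))) lam"
    and "is_tuple_tree M \<kappa> lam a"
    and "s_indiscernible L M \<kappa> C lam a"
  shows "\<exists>b :: nat node \<Rightarrow> 'k \<Rightarrow> 'm.
           is_tuple_tree M \<kappa> natLeq b \<and>
           str_indiscernible L M \<kappa> C natLeq b \<and>
           str_based L M \<kappa> C natLeq b lam a"
proof -
  have wo: "Well_order lam" using assms(7) by (auto simp: is_beth_def card_order_on_def)
  obtain H :: "nat \<Rightarrow> nat \<Rightarrow> 'l" where H: "\<forall>n. increasing lam (H n)"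
    "\<forall>\<eta>s K m n f g. set \<eta>s \<subseteq> tree natLeq \<and> (\<forall>\<eta>\<in>set \<eta>s. len \<eta> < K) \<and>
      K \<le> m \<and> K \<le> n \<and> strict_mono f \<and> strict_mono g \<longrightarrow>
      same_type L M \<kappa> C a (map (emb lam (H m \<circ> f)) \<eta>s) a (map (emb lam (H n \<circ> g)) \<eta>s)"
    using homogeneous_levels[OF assms(5,7), of M a] by (elim exE conjE)
  note inc = H(1)[rule_format]
  have hom: "same_type L M \<kappa> C a (map (emb lam (H m \<circ> f)) \<eta>s) a (map (emb lam (H n \<circ> g)) \<eta>s)"
    if "set \<eta>s \<subseteq> tree natLeq" "\<And>\<eta>. \<eta> \<in> set \<eta>s \<Longrightarrow> len \<eta> < K" "K \<le> m" "K \<le> n"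
      "strict_mono f" "strict_mono g" for \<eta>s K m n f g
    by (rule H(2)[rule_format]) (use that in blast)
  have emb: "level_embedding lam (H n)" for n using wo inc by unfold_locales
  \<comment> \<open>The pullback of \<open>a\<close> along the levels \<open>H n\<close>. Its type
    on a given finite tuple settles once \<open>n\<close> exceeds all lengths in the tuple.\<close>
  define A where "A = (\<lambda>n \<eta>. a (emb lam (H n) \<eta>))"
  have A_type: "same_type L M \<kappa> C c \<nu>s (A n) \<eta>s \<longleftrightarrow> same_type L M \<kappa> C c \<nu>s a (map (emb lam (H n)) \<eta>s)"
    for c :: "'j node \<Rightarrow> 'k \<Rightarrow> 'm" and \<nu>s \<eta>s n
  proof -
    have "positive_type L M C ({..<length \<eta>s} \<times> Field \<kappa>) (tuple_at (A n) \<eta>s) =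
        positive_type L M C ({..<length \<eta>s} \<times> Field \<kappa>) (tuple_at a (map (emb lam (H n)) \<eta>s))"
    proof -
      have "satisfies M (tuple_at (A n) \<eta>s) p \<longleftrightarrow> satisfies M (tuple_at a (map (emb lam (H n)) \<eta>s)) p"
        if "p \<in> Pfm L ({..<length \<eta>s} \<times> Field \<kappa>) C" for p
      proof (cases p)
        case (Pair \<phi> \<sigma>)
        show ?thesis unfolding Pair
          by (rule satisfies_cong[OF that[unfolded Pair]]) (auto simp: tuple_at_def A_def)
      qed
      thus ?thesis by (auto simp: positive_type_def)
    qed
    thus ?thesis by (simp add: same_type_def)
  qed
  have bound: "len \<eta> < Suc (sum_list (map len \<eta>s))" if "\<eta> \<in> set \<eta>s" for \<eta> \<eta>s
    using member_le_sum_list[of "len \<eta>" "map len \<eta>s"] that by auto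
  have "\<exists>b. is_tuple_tree M \<kappa> natLeq b \<and>
    (\<forall>\<eta>s. set \<eta>s \<subseteq> tree natLeq \<longrightarrow> (\<exists>K. \<forall>n\<ge>K. same_type L M \<kappa> C b \<eta>s (A n) \<eta>s))"
  proof (rule limit_tree_exists[OF assms(1-6)])
    show "is_tuple_tree M \<kappa> natLeq (A n)" for n
      using assms(8) level_embedding.emb_tree[OF emb] by (auto simp: is_tuple_tree_def A_def)
    fix \<eta>s :: "nat node list" assume \<eta>s: "set \<eta>s \<subseteq> tree natLeq"
    let ?K = "Suc (sum_list (map len \<eta>s))"
    have "same_type L M \<kappa> C (A ?K) \<eta>s (A n) \<eta>s" if "?K \<le> n" for n
    proof -
      have "same_type L M \<kappa> C a (map (emb lam (H n)) \<eta>s) a (map (emb lam (H ?K)) \<eta>s)"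
        using hom[OF \<eta>s bound that order_refl, of id id] by (simp add: strict_mono_def)
      thus ?thesis unfolding A_type[symmetric] by (metis A_type same_type_sym)
    qed
    thus "\<exists>K. \<forall>n\<ge>K. same_type L M \<kappa> C (A K) \<eta>s (A n) \<eta>s" by blast
  qed
  then obtain b where b: "is_tuple_tree M \<kappa> natLeq b"
    "\<And>\<eta>s. set \<eta>s \<subseteq> tree natLeq \<Longrightarrow> \<exists>K. \<forall>n\<ge>K. same_type L M \<kappa> C b \<eta>s a (map (emb lam (H n)) \<eta>s)"
    unfolding A_type by blast
  have "str_based L M \<kappa> C natLeq b lam a" unfolding str_based_def
  proof (intro allI impI)
    fix \<eta>s assume \<eta>s: "set \<eta>s \<subseteq> tree natLeq"
    obtain n where n: "same_type L M \<kappa> C b \<eta>s a (map (emb lam (H n)) \<eta>s)" using b(2)[OF \<eta>s] by blast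
    show "\<exists>\<nu>s. set \<nu>s \<subseteq> tree lam \<and> str_qf_equiv lam \<nu>s natLeq \<eta>s \<and> same_type L M \<kappa> C b \<eta>s a \<nu>s"
      using n level_embedding.emb_tree[OF emb] level_embedding.str_qf_equiv_emb[OF emb \<eta>s]
      by (intro exI[of _ "map (emb lam (H n)) \<eta>s"]) auto
  qed
  moreover have "str_indiscernible L M \<kappa> C natLeq b" unfolding str_indiscernible_def
  proof (intro allI impI, elim conjE)
    fix \<eta>s \<nu>s assume \<eta>s: "set \<eta>s \<subseteq> tree natLeq" and \<nu>s: "set \<nu>s \<subseteq> tree natLeq"
      and eq: "str_qf_equiv natLeq \<eta>s natLeq \<nu>s"
    obtain K1 K2 where K1: "\<forall>n\<ge>K1. same_type L M \<kappa> C b \<eta>s a (map (emb lam (H n)) \<eta>s)"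
      and K2: "\<forall>n\<ge>K2. same_type L M \<kappa> C b \<nu>s a (map (emb lam (H n)) \<nu>s)"
      using b(2)[OF \<eta>s] b(2)[OF \<nu>s] by blast
    let ?ka = "Suc (sum_list (map len \<eta>s))" and ?kb = "Suc (sum_list (map len \<nu>s))"
    \<comment> \<open>Large enough for both limits to be attained and for \<open>H n\<close> to be
      homogeneous for the levels of both tuples.\<close>
    define n where "n = K1 + K2 + ?ka + ?kb"
    obtain f g :: "nat \<Rightarrow> nat" where fg: "strict_mono f" "strict_mono g"
      and s: "s_qf_equiv lam (map (emb lam (H n \<circ> f)) \<eta>s) (map (emb lam (H n \<circ> g)) \<nu>s)"
      by (rule str_equiv_imp_s_equiv_emb[OF wo inc \<eta>s \<nu>s eq])
    have id: "strict_mono (id :: nat \<Rightarrow> nat)" by (simp add: strict_mono_def)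
    have tree: "set (map (emb lam (H n \<circ> f)) \<xi>s) \<subseteq> tree lam" if "strict_mono f" for f and \<xi>s
    proof -
      have "level_embedding lam (H n \<circ> f)" using wo increasing_comp[OF inc that] by unfold_locales
      thus ?thesis using level_embedding.emb_tree by auto
    qed
    have le: "?ka \<le> n" "?kb \<le> n" by (auto simp: n_def)
    \<comment> \<open>On each side, the limit leads from \<open>b\<close> to \<open>H n\<close>, and
      homogeneity from \<open>H n\<close> to a thinned sequence; in the middle, the two thinned
      images have the same s-type, where the s-indiscernibility of \<open>a\<close> applies.\<close>
    have "same_type L M \<kappa> C b \<eta>s a (map (emb lam (H n)) \<eta>s)" using K1 by (simp add: n_def)
    also have "same_type L M \<kappa> C a (map (emb lam (H n)) \<eta>s) a (map (emb lam (H n \<circ> f)) \<eta>s)"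
      using hom[OF \<eta>s bound le(1) le(1) id fg(1)] by simp
    also have "same_type L M \<kappa> C a (map (emb lam (H n \<circ> f)) \<eta>s) a (map (emb lam (H n \<circ> g)) \<nu>s)"
      using assms(9) s tree[OF fg(1)] tree[OF fg(2)] unfolding s_indiscernible_def by blast
    also have "same_type L M \<kappa> C a (map (emb lam (H n \<circ> g)) \<nu>s) a (map (emb lam (H n)) \<nu>s)"
      using hom[OF \<nu>s bound le(2) le(2) fg(2) id] by simp
    also have "same_type L M \<kappa> C a (map (emb lam (H n)) \<nu>s) b \<nu>s"
      by (rule same_type_sym) (use K2 in \<open>simp add: n_def\<close>)
    finally show "same_type L M \<kappa> C b \<eta>s b \<nu>s" .
  qed
  ultimately show ?thesis using b(1) by blast
qed

end
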